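(* Let $\lambda>0$, $\alpha,\gamma\ge 0$ and $\delta>1$. Consider the one-dimensional weight-dependent random connection model with vertex intensity $\lambda$, profile function $\rho(x)=1\wedge x^{-\delta}$ and interpolation kernel $g(s,t)=(s\wedge t)^\gamma(s\vee t)^\alpha$, augmented by nearest-neighbour edges. If $$\delta>2,\qquad \gamma<1-\frac1\delta,\qquad \alpha<1-\gamma,$$ then the graph, equivalently its unique infinite connected component, is recurrent almost surely.
   Context: The weight-dependent random connection model (WDRCM) in dimension $d$ with profile $\rho:(0,\infty)\to[0,1]$ and kernel $g:(0,1)^2\to(0,\infty)$ is the following random graph. The vertex set $V$ is a homogeneous Poisson point process on $\mathbb{R}^d$ of intensity $\lambda>0$. Conditionally on $V$, the vertices $v\in V$ carry i.i.d. marks $u_v$ uniformly distributed on $(0,1)$. Given the vertices and marks, each pair of distinct vertices $v,w$ is connected by an edge with probability $\rho\big(g(u_v,u_w)\,|v-w|^d\big)$, independently of all other pairs. Here $d=1$. Augmentation by nearest-neighbour edges (in $d=1$): order the vertices by location, $V=(v_i)_{i\in\mathbb{Z}}$ with $v_i<v_j$ for $i<j$, and add all edges $\{v_i,v_{i+1}\}$, $i\in\mathbb{Z}$, to the graph (if not already present). Graphs are regarded as electrical networks with unit conductances. A connected component is recurrent if the effective resistance from one (equivalently every) vertex of that component to infinity is infinite (equivalently, simple random walk on it is recurrent). *)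

theory Defs
  imports "HOL-Probability.Probability"
begin

section \<open>Recurrence of graphs as electrical networks with unit conductances\<close>

text \<open>A simple graph is given by a vertex set \<open>V\<close> and a set \<open>E\<close> of unordered pairs of vertices.\<close>

definition nbrs :: "'v set \<Rightarrow> 'v set set \<Rightarrow> 'v \<Rightarrow> 'v set" where
  "nbrs V E v = {w \<in> V. w \<noteq> v \<and> {v, w} \<in> E}"

definition graph_components :: "'v set \<Rightarrow> 'v set set \<Rightarrow> 'v set set" where
  "graph_components V E = V // {(v, w). v \<in> V \<and> w \<in> nbrs V E v}\<^sup>*"

text \<open>The voltage when \<open>v\<close> is held at potential 1 and every vertex outside \<open>K\<close> is grounded:
  by Kirchhoff's and Ohm's laws, no net current leaves any other vertex of \<open>K\<close>.\<close>

definition voltage :: "'v set \<Rightarrow> 'v set set \<Rightarrow> 'v \<Rightarrow> 'v set \<Rightarrow> ('v \<Rightarrow> real) \<Rightarrow> bool" where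
  "voltage V E v K h \<longleftrightarrow>
     h v = 1 \<and> (\<forall>w\<in>V - K. h w = 0) \<and> (\<forall>w\<in>K - {v}. (\<Sum>y\<in>nbrs V E w. h w - h y) = 0)"

text \<open>Effective resistance between \<open>v\<close> and \<open>V - K\<close>: potential difference 1 divided by the total
  current out of \<open>v\<close>, so it is \<open>\<infinity>\<close> if no current flows. For a locally finite graph and
  finite \<open>K \<subseteq> V\<close> with \<open>v \<in> K\<close> a voltage exists, and the current out of \<open>v\<close> does not depend on
  its choice (only the values on components inside \<open>K\<close> that avoid \<open>v\<close> are not determined).\<close>

definition eff_resistance :: "'v set \<Rightarrow> 'v set set \<Rightarrow> 'v \<Rightarrow> 'v set \<Rightarrow> ennreal" where
  "eff_resistance V E v K =
     (THE r. \<exists>h. voltage V E v K h \<and> r = 1 / ennreal (\<Sum>y\<in>nbrs V E v. h v - h y))"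

text \<open>The resistance to infinity is the limit along exhaustions of \<open>V\<close> by finite sets, which is
  a supremum since the resistance increases with \<open>K\<close>.\<close>

definition eff_resistance_infinity :: "'v set \<Rightarrow> 'v set set \<Rightarrow> 'v \<Rightarrow> ennreal" where
  "eff_resistance_infinity V E v =
     (SUP K\<in>{K. finite K \<and> v \<in> K \<and> K \<subseteq> V}. eff_resistance V E v K)"

text \<open>Local finiteness is required because the voltages above (and simple random walk) only make
  sense at finite degrees; without it \<open>\<Sum>\<close> over an infinite neighbourhood would be 0.\<close>

definition recurrent_component :: "'v set \<Rightarrow> 'v set set \<Rightarrow> 'v set \<Rightarrow> bool" where
  "recurrent_component V E C \<longleftrightarrow>
     (\<forall>v\<in>C. finite (nbrs V E v)) \<and> (\<forall>v\<in>C. eff_resistance_infinity V E v = \<infinity>)"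

definition recurrent_graph :: "'v set \<Rightarrow> 'v set set \<Rightarrow> bool" where
  "recurrent_graph V E \<longleftrightarrow> (\<forall>C\<in>graph_components V E. recurrent_component V E C)"

text \<open>The edges joining consecutive points of \<open>V \<subseteq> \<real>\<close>. The ordering \<open>p\<close> is unique up to an index
  shift, so quantifying over all of them adds no further edges.\<close>

definition nearest_neighbour_edges :: "real set \<Rightarrow> real set set" where
  "nearest_neighbour_edges V =
     {{p i, p (i + 1)} | (p :: int \<Rightarrow> real) i. strict_mono p \<and> range p = V}"


section \<open>The weight-dependent random connection model\<close>

text \<open>Homogeneous Poisson point process of intensity \<open>lam\<close>, as a random locally finite set. Finite
  families of sets are covered by padding with the empty set.\<close>

definition (in prob_space) poisson_process ::
    "real \<Rightarrow> ('a \<Rightarrow> 'b::euclidean_space set) \<Rightarrow> bool" where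
  "poisson_process lam V \<longleftrightarrow>
     (AE \<omega> in M. \<forall>B. bounded B \<longrightarrow> finite (V \<omega> \<inter> B)) \<and>
     (\<forall>B\<in>sets borel. bounded B \<longrightarrow>
        (\<forall>k. prob {\<omega> \<in> space M. card (V \<omega> \<inter> B) = k} =
             exp (- (lam * measure lborel B)) * (lam * measure lborel B) ^ k / fact k)) \<and>
     (\<forall>B :: nat \<Rightarrow> 'b set. (\<forall>n. B n \<in> sets borel \<and> bounded (B n)) \<and> disjoint_family B \<longrightarrow>
        indep_vars (\<lambda>_. count_space UNIV) (\<lambda>n \<omega>. card (V \<omega> \<inter> B n)) UNIV)"

text \<open>The vertices are given by a measurable enumeration \<open>X\<close> of the Poisson process (almost surely
  an infinite set, as \<open>lam > 0\<close>), \<open>U n\<close> is the mark of the vertex \<open>X n\<close>, and \<open>E \<omega>\<close> is the set of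
  edges. \<open>marks\<close> says that given the vertices the marks are i.i.d. uniform on (0,1). \<open>edges\<close> says
  that given vertices and marks the edges are independent with the prescribed probabilities: as for
  \<open>indep_events\<close>, it suffices to consider the presence of finitely many edges. Each pair of
  vertices is listed once, as \<open>i < j\<close>; the kernel \<open>g\<close> is meant to be symmetric.\<close>

locale wdrcm = prob_space M for M :: "'w measure" +
  fixes lam :: real and rho :: "real \<Rightarrow> real" and g :: "real \<Rightarrow> real \<Rightarrow> real"
    and X :: "nat \<Rightarrow> 'w \<Rightarrow> 'a::euclidean_space" and U :: "nat \<Rightarrow> 'w \<Rightarrow> real"
    and E :: "'w \<Rightarrow> 'a set set"
  assumes intensity: "lam > 0"
    and profile: "\<And>t. t > 0 \<Longrightarrow> rho t \<in> {0..1}"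
    and kernel: "\<And>s t. s \<in> {0<..<1} \<Longrightarrow> t \<in> {0<..<1} \<Longrightarrow> g s t > 0"
    and X_measurable: "\<And>n. X n \<in> borel_measurable M"
    and U_measurable: "\<And>n. U n \<in> borel_measurable M"
    and X_distinct: "AE \<omega> in M. inj (\<lambda>n. X n \<omega>)"
    and vertices: "poisson_process lam (\<lambda>\<omega>. range (\<lambda>n. X n \<omega>))"
    and marks:
      "distr M (Pi\<^sub>M UNIV (\<lambda>_. borel) \<Otimes>\<^sub>M Pi\<^sub>M UNIV (\<lambda>_. borel)) (\<lambda>\<omega>. (\<lambda>n. X n \<omega>, \<lambda>n. U n \<omega>)) =
       distr M (Pi\<^sub>M UNIV (\<lambda>_. borel)) (\<lambda>\<omega> n. X n \<omega>) \<Otimes>\<^sub>M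
         Pi\<^sub>M UNIV (\<lambda>_. uniform_measure lborel {0<..<1})"
    and edge_set: "AE \<omega> in M. E \<omega> \<subseteq> {{X i \<omega>, X j \<omega>} | i j. i < j}"
    and edge_event: "\<And>i j. i < j \<Longrightarrow> {\<omega> \<in> space M. {X i \<omega>, X j \<omega>} \<in> E \<omega>} \<in> events"
    and edges: "\<And>F. finite F \<Longrightarrow> F \<subseteq> {(i, j). i < j} \<Longrightarrow>
      AE \<omega> in M.
        real_cond_exp M
          (vimage_algebra (space M) (\<lambda>\<omega>. (\<lambda>n. X n \<omega>, \<lambda>n. U n \<omega>))
             (Pi\<^sub>M UNIV (\<lambda>_. borel) \<Otimes>\<^sub>M Pi\<^sub>M UNIV (\<lambda>_. borel)))
          (indicator {\<omega> \<in> space M. \<forall>(i, j)\<in>F. {X i \<omega>, X j \<omega>} \<in> E \<omega>}) \<omega> =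
        (\<Prod>(i, j)\<in>F. rho (g (U i \<omega>) (U j \<omega>) * norm (X i \<omega> - X j \<omega>) ^ DIM('a)))"

end

theory Submission
  imports Defs
begin

text \<open>Call a location \<open>c\<close> uncrossed if no random edge joins the vertices to its left and to its right, so
  that only one nearest-neighbour edge crosses it. If there are uncrossed locations arbitrarily far out
  on both sides, the graph is recurrent by the Nash-Williams criterion, with cutsets of two edges.

  Uncrossed locations are found at large gaps of the Poisson process. Among \<open>j e^(2 \<lambda> N)\<close> disjoint
  intervals of length \<open>2 N\<close> one is empty with probability at least \<open>1 - e^-j\<close>. Given that such an interval is
  empty, the probability that an edge crosses it tends to 0 as \<open>N\<close> grows: up to small probability every
  vertex at distance \<open>x\<close> from the midpoint has mark at least \<open>x^-\<zeta>\<close> with some \<open>\<zeta> > 1\<close>, and under this truncation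
  the expected number of crossing edges is small. The hypotheses on \<open>\<alpha>, \<gamma>, \<delta>\<close> are exactly what makes the
  truncated connection probability at most \<open>(s t)^(\<theta>-1) (x y)^-\<tau>\<close> for some \<open>\<theta> > 0\<close> and \<open>\<tau> > 1\<close>, for marks
  \<open>s, t\<close> and distances \<open>x, y\<close> of the end points to the midpoint.\<close>

section \<open>The Nash-Williams criterion\<close>

text \<open>The obstacle is that an interval of length \<open>2 * real N\<close> is void only with
  probability \<open>p = exp (- (lam * (2 * real N)))\<close>, so about \<open>j / p\<close>
  intervals have to be tried, and their crossing events are dependent through shared vertices and
  edges. A plain union bound copes with this, because every estimate at one interval keeps the
  factor \<open>p\<close> of the void event: "void but crossed" has probability at most
  \<open>p * crossing_rate N\<close>, so all intervals together cost at most
  \<open>(j + 1) * crossing_rate N\<close>. Hence \<open>j\<close> is fixed first and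
  \<open>N\<close> is taken large afterwards. Since every error probability can be reached in every
  far region, almost sure existence follows without a zero-one law. The exponents balance as
  follows. \<zeta> > 1 makes the expected number of vertices with too small a mark summable. A mark
  above \<open>x powr - \<zeta>\<close> costs a factor of at most \<open>x powr \<kappa>\<close>.
  The decay \<delta> - \<kappa> that remains is shared equally by the two end points, \<tau> =
  (\<delta> - \<kappa>) / 2, and \<tau> > 1 means \<kappa> < \<delta> - 2.\<close>

lemma nbrs_sym: "v \<in> V \<Longrightarrow> w \<in> nbrs V E v \<Longrightarrow> v \<in> nbrs V E w"
  unfolding nbrs_def by (auto simp: insert_commute)

text \<open>Discrete Green identity. Exchanging the names \<open>w\<close> and \<open>y\<close>
  turns the \<open>f y\<close> half of the double sum into minus the \<open>f w\<close> half,
  because \<open>e\<close> is symmetric and \<open>h w - h y\<close> changes sign. It serves with a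
  potential \<open>f\<close> for energies, and with constant \<open>f\<close> for the cancellation
  of internal currents.\<close>

lemma sum_by_parts:
  fixes f h :: "'v \<Rightarrow> real" and e :: "'v \<Rightarrow> 'v \<Rightarrow> real"
  assumes "\<And>w y. w \<in> W \<Longrightarrow> y \<in> W \<Longrightarrow> e w y = e y w"
  shows "(\<Sum>w\<in>W. \<Sum>y\<in>W. e w y * ((f w - f y) * (h w - h y))) =
    2 * (\<Sum>w\<in>W. f w * (\<Sum>y\<in>W. e w y * (h w - h y)))"
proof -
  have "(\<Sum>w\<in>W. \<Sum>y\<in>W. e w y * (f y * (h w - h y))) =
      (\<Sum>y\<in>W. \<Sum>w\<in>W. e w y * (f y * (h w - h y)))"
    by (rule sum.swap)
  also have "\<dots> = (\<Sum>w\<in>W. \<Sum>y\<in>W. - (e w y * (f w * (h w - h y))))"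
    by (intro sum.cong refl) (simp add: assms algebra_simps)
  finally have "(\<Sum>w\<in>W. \<Sum>y\<in>W. e w y * (f y * (h w - h y))) =
      - (\<Sum>w\<in>W. \<Sum>y\<in>W. e w y * (f w * (h w - h y)))"
    by (simp add: sum_negf)
  moreover have "(\<Sum>w\<in>W. \<Sum>y\<in>W. e w y * ((f w - f y) * (h w - h y))) =
      (\<Sum>w\<in>W. \<Sum>y\<in>W. e w y * (f w * (h w - h y))) - (\<Sum>w\<in>W. \<Sum>y\<in>W. e w y * (f y * (h w - h y)))"
    by (simp add: sum_subtractf[symmetric] algebra_simps)
  ultimately show ?thesis
    by (simp add: sum_distrib_left algebra_simps)
qed

text \<open>A voltage is a fixed point of local averaging. Iterating the averaging operator
  \<open>T\<close> from 0 gives an increasing sequence bounded by 1, and its limit is a fixed point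
  because \<open>T\<close> passes to pointwise limits.\<close>

lemma voltage_exists:
  assumes "\<And>w. w \<in> K \<Longrightarrow> finite (nbrs V E w)" and "K \<subseteq> V" and "v \<in> K"
  shows "\<exists>h. voltage V E v K h"
proof -
  \<comment> \<open>At an isolated vertex of \<open>K\<close> the quotient is 0 / 0 = 0, which is
    harmless: Kirchhoff's law is an empty sum there.\<close>
  define T where "T f w = (if w = v then 1 else if w \<in> K
      then (\<Sum>y\<in>nbrs V E w. f y) / real (card (nbrs V E w)) else 0)" for f :: "'a \<Rightarrow> real" and w
  define u where "u n = (T ^^ n) (\<lambda>_. 0)" for n
  have u_Suc: "u (Suc n) = T (u n)" for n by (simp add: u_def)
  have T_mono: "T f w \<le> T f' w" if "\<And>w. f w \<le> f' w" for f f' w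
    unfolding T_def by (auto intro!: divide_right_mono sum_mono that)
  have T_le: "T f w \<le> 1" if "\<And>w. f w \<le> 1" for f w
  proof -
    have "(\<Sum>y\<in>nbrs V E w. f y) \<le> (\<Sum>y\<in>nbrs V E w. 1)" by (intro sum_mono that)
    then show ?thesis unfolding T_def by (auto simp: divide_le_eq_1)
  qed
  have T_nonneg: "0 \<le> T f w" if "\<And>w. 0 \<le> f w" for f w
    unfolding T_def by (auto intro!: divide_nonneg_nonneg sum_nonneg that)
  have nonneg: "0 \<le> u n w" for n w
    by (induction n arbitrary: w) (simp_all add: u_Suc T_nonneg, simp add: u_def)
  have le: "u n w \<le> 1" for n w
    by (induction n arbitrary: w) (simp_all add: u_Suc T_le, simp add: u_def)
  have step: "u n w \<le> u (Suc n) w" for n w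
  proof (induction n arbitrary: w)
    case 0
    show ?case using nonneg[of 1 w] by (simp add: u_def)
  next
    case (Suc n)
    then show ?case using T_mono by (simp add: u_Suc)
  qed
  have "\<exists>l. (\<lambda>n. u n w) \<longlonglongrightarrow> l" for w
    using incseq_convergent[of "\<lambda>n. u n w" 1] by (metis incseq_Suc_iff step le)
  then obtain h where h: "\<And>w. (\<lambda>n. u n w) \<longlonglongrightarrow> h w" by metis
  have "h w = T h w" for w
  proof (rule LIMSEQ_unique)
    show "(\<lambda>n. u (Suc n) w) \<longlonglongrightarrow> h w" using h by (rule LIMSEQ_Suc)
    have "(\<lambda>n. T (u n) w) \<longlonglongrightarrow> T h w"
      unfolding T_def divide_inverse by (auto intro!: tendsto_intros h)
    then show "(\<lambda>n. u (Suc n) w) \<longlonglongrightarrow> T h w" by (simp add: u_Suc)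
  qed
  then have h_fix: "h w = (if w = v then 1 else if w \<in> K
      then (\<Sum>y\<in>nbrs V E w. h y) / real (card (nbrs V E w)) else 0)" for w
    unfolding T_def .
  have "(\<Sum>y\<in>nbrs V E w. h w - h y) = 0" if "w \<in> K - {v}" for w
  proof (cases "nbrs V E w = {}")
    case False
    then have "card (nbrs V E w) \<noteq> 0" using assms(1) that by auto
    then have "real (card (nbrs V E w)) * h w = (\<Sum>y\<in>nbrs V E w. h y)"
      using h_fix[of w] that by (auto simp: field_simps)
    then show ?thesis by (simp add: sum_subtractf)
  qed simp
  moreover have "h v = 1" "\<forall>w\<in>V - K. h w = 0"
    using h_fix assms(3) by auto
  ultimately have "voltage V E v K h" unfolding voltage_def by blast
  then show ?thesis by blast
qed

section \<open>Energy and current in a finite network\<close>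

locale finite_network =
  fixes V :: "'v set" and E :: "'v set set" and v :: 'v and K :: "'v set"
  assumes finite_K: "finite K" and K_subset: "K \<subseteq> V" and v_in_K: "v \<in> K"
    and finite_nbrs: "\<And>w. w \<in> K \<Longrightarrow> finite (nbrs V E w)"
begin

text \<open>Large enough to contain both ends of every edge that meets \<open>K\<close>, and finite,
  so that energies are finite double sums.\<close>

definition W where "W = K \<union> (\<Union>w\<in>K. nbrs V E w)"

text \<open>The Dirichlet form over ordered pairs: every edge inside \<open>W\<close> counts in both
  directions, whence the factor 2 in the identities below.\<close>

definition form :: "('v \<Rightarrow> real) \<Rightarrow> ('v \<Rightarrow> real) \<Rightarrow> real" where
  "form f h = (\<Sum>w\<in>W. \<Sum>y\<in>W. of_bool (y \<in> nbrs V E w) * ((f w - f y) * (h w - h y)))"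

lemma finite_W: "finite W"
  unfolding W_def using finite_K finite_nbrs by auto

lemma W_subset: "W \<subseteq> V"
  unfolding W_def using K_subset by (auto simp: nbrs_def)

text \<open>Summation by parts leaves \<open>f w\<close> times the divergence of \<open>h\<close> at
  \<open>w\<close>. On \<open>K - {v}\<close> Kirchhoff's law kills the divergence. Outside
  \<open>K\<close> the inner sum over \<open>W\<close> may miss neighbours of \<open>w\<close>, but
  there \<open>f w = 0\<close>.\<close>

lemma form_voltage:
  assumes f: "\<And>w. w \<in> V - K \<Longrightarrow> f w = 0" and h: "voltage V E v K h"
  shows "form f h = 2 * (f v * (\<Sum>y\<in>nbrs V E v. h v - h y))"
proof -
  let ?e = "\<lambda>w y. of_bool (y \<in> nbrs V E w) :: real"
  have div: "(\<Sum>y\<in>W. ?e w y * (h w - h y)) = (\<Sum>y\<in>nbrs V E w. h w - h y)" if "w \<in> K" for w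
  proof -
    have "nbrs V E w \<subseteq> W" using that by (auto simp: W_def)
    then show ?thesis using finite_W by (intro sum.mono_neutral_cong_right) auto
  qed
  have "form f h = 2 * (\<Sum>w\<in>W. f w * (\<Sum>y\<in>W. ?e w y * (h w - h y)))"
    unfolding form_def using W_subset
    by (intro sum_by_parts) (auto simp: of_bool_def dest: nbrs_sym)
  also have "(\<Sum>w\<in>W. f w * (\<Sum>y\<in>W. ?e w y * (h w - h y))) =
      (\<Sum>w\<in>{v}. f w * (\<Sum>y\<in>W. ?e w y * (h w - h y)))"
  proof (rule sum.mono_neutral_right[OF finite_W])
    show "{v} \<subseteq> W" using v_in_K by (auto simp: W_def)
    show "\<forall>w\<in>W - {v}. f w * (\<Sum>y\<in>W. ?e w y * (h w - h y)) = 0"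
    proof
      fix w assume w: "w \<in> W - {v}"
      show "f w * (\<Sum>y\<in>W. ?e w y * (h w - h y)) = 0"
        using w h W_subset f[of w] by (cases "w \<in> K") (auto simp: div voltage_def)
    qed
  qed
  finally show ?thesis using div[OF v_in_K] by simp
qed

text \<open>Reciprocity: \<open>form h h'\<close> is symmetric and equals twice the current of
  either voltage. This gives \<open>THE\<close> in \<open>eff_resistance\<close> its meaning
  although the voltage itself need not be unique.\<close>

lemma current_unique:
  assumes "voltage V E v K h" "voltage V E v K h'"
  shows "(\<Sum>y\<in>nbrs V E v. h v - h y) = (\<Sum>y\<in>nbrs V E v. h' v - h' y)"
proof -
  have "form h h' = form h' h" unfolding form_def by (simp add: mult.commute)
  moreover have "form h h' = 2 * (h v * (\<Sum>y\<in>nbrs V E v. h' v - h' y))"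
    using assms by (intro form_voltage) (auto simp: voltage_def)
  moreover have "form h' h = 2 * (h' v * (\<Sum>y\<in>nbrs V E v. h v - h y))"
    using assms by (intro form_voltage) (auto simp: voltage_def)
  ultimately show ?thesis using assms by (simp add: voltage_def)
qed

lemma eff_resistance_eq:
  assumes "voltage V E v K h"
  shows "eff_resistance V E v K = 1 / ennreal (\<Sum>y\<in>nbrs V E v. h v - h y)"
  unfolding eff_resistance_def
proof (rule the_equality)
  show "\<exists>h'. voltage V E v K h' \<and>
      1 / ennreal (\<Sum>y\<in>nbrs V E v. h v - h y) = 1 / ennreal (\<Sum>y\<in>nbrs V E v. h' v - h' y)"
    using assms by blast
next
  fix r assume "\<exists>h'. voltage V E v K h' \<and> r = 1 / ennreal (\<Sum>y\<in>nbrs V E v. h' v - h' y)"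
  then show "r = 1 / ennreal (\<Sum>y\<in>nbrs V E v. h v - h y)"
    using current_unique[OF assms] by auto
qed

text \<open>Pairs are oriented outwards, so that summing \<open>h w - h y\<close> over them gives
  the net current leaving \<open>B\<close>.\<close>

definition edge_boundary :: "'v set \<Rightarrow> ('v \<times> 'v) set" where
  "edge_boundary B = (SIGMA w:B. nbrs V E w - B)"

text \<open>The divergence is summed over \<open>B\<close>: by Kirchhoff's law only \<open>v\<close>
  contributes, and the edges inside \<open>B\<close> cancel.\<close>

lemma current_through_boundary:
  assumes B: "v \<in> B" "B \<subseteq> K" and h: "voltage V E v K h"
  shows "(\<Sum>y\<in>nbrs V E v. h v - h y) = (\<Sum>(w, y)\<in>edge_boundary B. h w - h y)"
proof -
  let ?e = "\<lambda>w y. of_bool (y \<in> nbrs V E w) :: real"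
  have finB: "finite B" using B(2) finite_K finite_subset by blast
  have inner: "(\<Sum>w\<in>B. \<Sum>y\<in>nbrs V E w \<inter> B. h w - h y) = 0"
  proof -
    have "(\<Sum>w\<in>B. \<Sum>y\<in>nbrs V E w \<inter> B. h w - h y) = (\<Sum>w\<in>B. 1 * (\<Sum>y\<in>B. ?e w y * (h w - h y)))"
      using finB by (intro sum.cong refl) (simp, intro sum.mono_neutral_cong_left, auto)
    \<comment> \<open>Summation by parts with the constant function 1, whose differences
      vanish.\<close>
    also have "2 * \<dots> = (\<Sum>w\<in>B. \<Sum>y\<in>B. ?e w y * ((1 - 1) * (h w - h y)))"
      using B(2) K_subset
      by (intro sum_by_parts[symmetric]) (auto simp: of_bool_def dest: nbrs_sym)
    finally show ?thesis by simp
  qed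
  have "(\<Sum>w\<in>{v}. \<Sum>y\<in>nbrs V E w. h w - h y) = (\<Sum>w\<in>B. \<Sum>y\<in>nbrs V E w. h w - h y)"
  proof (rule sum.mono_neutral_left[OF finB])
    show "\<forall>w\<in>B - {v}. (\<Sum>y\<in>nbrs V E w. h w - h y) = 0"
      using B h unfolding voltage_def by blast
  qed (use B in auto)
  then have "(\<Sum>y\<in>nbrs V E v. h v - h y) = (\<Sum>w\<in>B. \<Sum>y\<in>nbrs V E w. h w - h y)" by simp
  also have "\<dots> = (\<Sum>w\<in>B. (\<Sum>y\<in>nbrs V E w \<inter> B. h w - h y) + (\<Sum>y\<in>nbrs V E w - B. h w - h y))"
    using B(2) finite_nbrs by (intro sum.cong refl sum.Int_Diff) auto
  also have "\<dots> = (\<Sum>w\<in>B. \<Sum>y\<in>nbrs V E w - B. h w - h y)"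
    by (simp add: sum.distrib inner)
  also have "\<dots> = (\<Sum>(w, y)\<in>edge_boundary B. h w - h y)"
    unfolding edge_boundary_def using finB B(2) finite_nbrs by (intro sum.Sigma) auto
  finally show ?thesis .
qed

text \<open>The Nash-Williams inequality for cutsets of bounded size; the factor 2 is not optimal.\<close>

lemma eff_resistance_ge:
  fixes B :: "nat \<Rightarrow> 'v set"
  assumes B: "\<And>i. i < k \<Longrightarrow> v \<in> B i" "\<And>i. i < k \<Longrightarrow> B i \<subseteq> K"
    and card: "\<And>i. i < k \<Longrightarrow> card (edge_boundary (B i)) \<le> n" and "n > 0"
    and disj: "disjoint_family_on (\<lambda>i. edge_boundary (B i)) {..<k}"
  shows "eff_resistance V E v K \<ge> ennreal (real k / (2 * real n))"
proof -
  obtain h where h: "voltage V E v K h"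
    using voltage_exists[OF finite_nbrs K_subset v_in_K] by blast
  define I where "I = (\<Sum>y\<in>nbrs V E v. h v - h y)"
  let ?d = "\<lambda>(w, y). (h w - h y)\<^sup>2"
  have bd_sub: "edge_boundary (B i) \<subseteq> {(w, y) \<in> W \<times> W. y \<in> nbrs V E w}" if "i < k" for i
    using B(2)[OF that] by (auto simp: edge_boundary_def W_def)
  have fin_bd: "finite (edge_boundary (B i))" if "i < k" for i
    by (rule finite_subset[OF bd_sub[OF that] finite_subset[of _ "W \<times> W"]]) (auto simp: finite_W)
  have form_hh: "form h h = 2 * I"
    using form_voltage[OF _ h, of h] h by (auto simp: I_def voltage_def)
  have "form h h = (\<Sum>w\<in>W. \<Sum>y\<in>W. if y \<in> nbrs V E w then ?d (w, y) else 0)"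
    unfolding form_def by (intro sum.cong) (auto simp: power2_eq_square)
  also have "\<dots> = (\<Sum>p\<in>W \<times> W. if snd p \<in> nbrs V E (fst p) then ?d p else 0)"
    by (subst sum.cartesian_product) (intro sum.cong, auto)
  also have "\<dots> = (\<Sum>p\<in>{(w, y) \<in> W \<times> W. y \<in> nbrs V E w}. ?d p)"
    using finite_W by (intro sum.mono_neutral_cong_right) auto
  finally have form_pairs: "form h h = (\<Sum>p\<in>{(w, y) \<in> W \<times> W. y \<in> nbrs V E w}. ?d p)" .
  have I_nonneg: "0 \<le> I"
  proof -
    have "0 \<le> form h h" unfolding form_pairs by (rule sum_nonneg) auto
    then show ?thesis using form_hh by simp
  qed
  \<comment> \<open>Cauchy-Schwarz on one cutset: the whole current \<open>I\<close> passes through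
    its at most \<open>n\<close> pairs.\<close>
  have one: "I\<^sup>2 \<le> real n * (\<Sum>p\<in>edge_boundary (B i). ?d p)" if i: "i < k" for i
  proof -
    have "I\<^sup>2 = (\<Sum>p\<in>edge_boundary (B i). (\<lambda>(w, y). h w - h y) p)\<^sup>2"
      unfolding I_def using current_through_boundary[OF B(1)[OF i] B(2)[OF i] h] by simp
    also have "\<dots> \<le> (\<Sum>p\<in>edge_boundary (B i). ((\<lambda>(w, y). h w - h y) p)\<^sup>2) * card (edge_boundary (B i))"
      by (rule sum_squared_le_sum_of_squares) 
    also have "\<dots> \<le> (\<Sum>p\<in>edge_boundary (B i). ?d p) * n"
      using card[OF i] by (intro mult_mono) (auto intro!: sum_nonneg simp: split_beta)
    finally show ?thesis by (simp add: mult.commute)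
  qed
  have "real k * I\<^sup>2 = (\<Sum>i<k. I\<^sup>2)" by simp
  also have "\<dots> \<le> (\<Sum>i<k. real n * (\<Sum>p\<in>edge_boundary (B i). ?d p))"
    using one by (intro sum_mono) auto
  also have "\<dots> = real n * (\<Sum>i<k. \<Sum>p\<in>edge_boundary (B i). ?d p)"
    by (simp add: sum_distrib_left)
  also have "(\<Sum>i<k. \<Sum>p\<in>edge_boundary (B i). ?d p) = (\<Sum>p\<in>(\<Union>i<k. edge_boundary (B i)). ?d p)"
    using disj fin_bd by (intro sum.UNION_disjoint[symmetric]) (auto simp: disjoint_family_on_def)
  \<comment> \<open>The boundaries are disjoint as sets of ordered pairs, so their energies add up
    to at most the full \<open>form h h\<close>. That form equals \<open>2 * I\<close>, which is
    where the factor 2 of the bound arises.\<close>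
  also have "real n * \<dots> \<le> real n * form h h"
    unfolding form_pairs using bd_sub finite_W
    by (intro mult_left_mono sum_mono2) (auto intro: finite_subset[of _ "W \<times> W"])
  finally have *: "real k * I * I \<le> 2 * real n * I"
    by (simp add: form_hh power2_eq_square mult.assoc)
  show ?thesis
  \<comment> \<open>Without current the resistance is \<open>1 / ennreal 0\<close>, which is
    infinite.\<close>
  proof (cases "I = 0 \<or> k = 0")
    case True
    then show ?thesis
      unfolding eff_resistance_eq[OF h] I_def[symmetric] by auto
  next
    case False
    then have pos: "I > 0" "k > 0" using I_nonneg by auto
    then have "real k * I \<le> 2 * real n" using * by simp
    then have "real k / (2 * real n) \<le> 1 / I"
      using pos \<open>n > 0\<close> by (simp add: field_simps)
    then have "ennreal (real k / (2 * real n)) \<le> ennreal (1 / I)" by (rule ennreal_leI)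
    also have "\<dots> = 1 / ennreal I" using pos by (simp add: divide_ennreal[symmetric])
    finally show ?thesis unfolding eff_resistance_eq[OF h] I_def[symmetric] .
  qed
qed

end

section \<open>Graphs on the line with uncrossed locations\<close>

definition consecutive :: "'a::linorder set \<Rightarrow> 'a \<Rightarrow> 'a \<Rightarrow> bool" where
  "consecutive V a b \<longleftrightarrow> a \<in> V \<and> b \<in> V \<and> a < b \<and> V \<inter> {a<..<b} = {}"

lemma consecutive_unique_right: "consecutive V a b \<Longrightarrow> consecutive V a b' \<Longrightarrow> b = b'"
  unfolding consecutive_def by (meson disjoint_iff greaterThanLessThan_iff not_less_iff_gr_or_eq)

lemma consecutive_unique_left: "consecutive V a b \<Longrightarrow> consecutive V a' b \<Longrightarrow> a = a'"
  unfolding consecutive_def by (meson disjoint_iff greaterThanLessThan_iff not_less_iff_gr_or_eq)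

text \<open>If \<open>a < a'\<close>, then \<open>a' < c \<le> b\<close> would put the vertex
  \<open>a'\<close> strictly between \<open>a\<close> and \<open>b\<close>, and symmetrically; so
  the left ends agree, and then the right ends. The convention \<open>a < c \<le> b\<close> is that
  of \<open>uncrossed\<close>.\<close>

lemma consecutive_unique_gap:
  assumes "consecutive V a b" "consecutive V a' b'" "a < c" "c \<le> b" "a' < c" "c \<le> b'"
  shows "a = a'" "b = b'"
proof -
  show "a = a'"
    using assms unfolding consecutive_def disjoint_iff
    by (metis (no_types, opaque_lifting) greaterThanLessThan_iff linorder_neqE order_less_le_trans)
  then show "b = b'" using assms consecutive_unique_right by blast
qed

lemma strict_mono_int_step:
  fixes p :: "int \<Rightarrow> 'a::linorder"
  assumes "\<And>i. p i < p (i + 1)"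
  shows "strict_mono p"
proof (rule strict_monoI)
  fix i j :: int assume "i < j"
  then show "p i < p j"
    by (induction rule: int_gr_induct) (use assms order_less_trans in blast)+
qed

section \<open>Locally finite vertex sets unbounded in both directions\<close>

locale line_vertices =
  fixes V :: "real set"
  assumes locally_finite: "\<And>B. bounded B \<Longrightarrow> finite (V \<inter> B)"
    and unbounded_above: "\<And>K. \<exists>x\<in>V. x > K"
    and unbounded_below: "\<And>K. \<exists>x\<in>V. x < K"
begin

lemma finite_interval: "finite (V \<inter> {a..b})"
  by (rule locally_finite) simp

lemma first_at_or_above: "\<exists>b\<in>V. c \<le> b \<and> V \<inter> {c..<b} = {}"
proof -
  obtain x where x: "x \<in> V" "x > c" using unbounded_above by blast
  define b where "b = Min (V \<inter> {c..x})"
  have "b \<in> V \<inter> {c..x}" unfolding b_def using x by (intro Min_in finite_interval) auto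
  moreover have "b \<le> y" if "y \<in> V" "c \<le> y" "y \<le> x" for y
    unfolding b_def using that by (intro Min_le finite_interval) auto
  ultimately show ?thesis by (intro bexI[of _ b]) force+
qed

lemma last_below: "\<exists>a\<in>V. a < c \<and> V \<inter> {a<..<c} = {}"
proof -
  obtain x where x: "x \<in> V" "x < c" using unbounded_below by blast
  have fin: "finite (V \<inter> {x..<c})"
    by (rule finite_subset[OF _ finite_interval[of x c]]) auto
  define a where "a = Max (V \<inter> {x..<c})"
  have "a \<in> V \<inter> {x..<c}" unfolding a_def using x fin by (intro Max_in) auto
  moreover have "y \<le> a" if "y \<in> V" "x \<le> y" "y < c" for y
    unfolding a_def using that fin by (intro Max_ge) auto
  ultimately show ?thesis by (intro bexI[of _ a]) force+
qed

lemma consecutive_around: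
  obtains a b where "consecutive V a b" "a < c" "c \<le> b"
proof -
  obtain a where a: "a \<in> V" "a < c" "V \<inter> {a<..<c} = {}" using last_below by blast
  obtain b where b: "b \<in> V" "c \<le> b" "V \<inter> {c..<b} = {}" using first_at_or_above by blast
  have "{a<..<b} \<subseteq> {a<..<c} \<union> {c..<b}" by auto
  then have "consecutive V a b" unfolding consecutive_def using a b by auto
  then show ?thesis using that a b by blast
qed

lemma next_vertex: "a \<in> V \<Longrightarrow> \<exists>b. consecutive V a b"
proof -
  assume a: "a \<in> V"
  obtain x where x: "x \<in> V" "x > a" using unbounded_above by blast
  have fin: "finite (V \<inter> {a<..x})"
    by (rule finite_subset[OF _ finite_interval[of a x]]) auto
  define b where "b = Min (V \<inter> {a<..x})"
  have "b \<in> V \<inter> {a<..x}" unfolding b_def using x fin by (intro Min_in) auto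
  moreover have "b \<le> y" if "y \<in> V" "a < y" "y \<le> x" for y
    unfolding b_def using that fin by (intro Min_le) auto
  ultimately show ?thesis using a by (intro exI[of _ b]) (force simp: consecutive_def)
qed

lemma previous_vertex: "b \<in> V \<Longrightarrow> \<exists>a. consecutive V a b"
  using last_below[of b] unfolding consecutive_def by blast

text \<open>Successors are iterated upwards and predecessors downwards from some \<open>v0\<close>.
  A vertex missed by \<open>p\<close> would bound one of the two half-sequences, trapping infinitely
  many vertices in a bounded interval.\<close>

lemma enumeration: "\<exists>p :: int \<Rightarrow> real. strict_mono p \<and> range p = V"
proof -
  obtain s where s: "\<And>a. a \<in> V \<Longrightarrow> consecutive V a (s a)" using next_vertex by metis
  obtain r where r: "\<And>b. b \<in> V \<Longrightarrow> consecutive V (r b) b" using previous_vertex by metis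
  have sV: "s a \<in> V" "r a \<in> V" "s (r a) = a" if "a \<in> V" for a
    using s[OF that] r[OF that] s[of "r a"] consecutive_unique_right[of V "r a" "s (r a)" a]
    by (auto simp: consecutive_def)
  obtain v0 where v0: "v0 \<in> V" using unbounded_above by blast
  define p where "p i = (if i \<ge> 0 then (s ^^ nat i) v0 else (r ^^ nat (- i)) v0)" for i :: int
  have pos: "(s ^^ n) v0 \<in> V" and neg: "(r ^^ n) v0 \<in> V" for n
    by (induction n) (auto simp: v0 sV)
  then have pV: "p i \<in> V" for i by (simp add: p_def)
  have p_Suc: "p (i + 1) = s (p i)" for i
  proof (cases "i \<ge> 0")
    case True
    then show ?thesis by (simp add: p_def nat_add_distrib)
  next
    case False
    \<comment> \<open>With \<open>i = - (n + 1)\<close>, \<open>p i\<close> is one predecessor step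
      beyond \<open>p (i + 1)\<close>; for \<open>n = 0\<close> the latter falls into the successor
      branch at index 0.\<close>
    define n where "n = nat (- i) - 1"
    have n: "i = - int (Suc n)" using False by (simp add: n_def)
    have "p i = r ((r ^^ n) v0)" by (simp add: p_def n nat_add_distrib)
    moreover have "p (i + 1) = (r ^^ n) v0" by (cases n) (simp_all add: p_def n nat_add_distrib)
    ultimately show ?thesis using sV(3)[OF neg] by simp
  qed
  have mono: "strict_mono p"
    by (rule strict_mono_int_step) (use s[OF pV] in \<open>simp add: p_Suc consecutive_def\<close>)
  then have inj: "inj p" by (rule strict_mono_imp_inj_on)
  have "v \<in> range p" if v: "v \<in> V" for v
  proof (rule ccontr)
    assume nv: "v \<notin> range p"
    show False
    proof (cases "\<exists>i. p i < v")
      case True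
      then obtain i where i: "p i < v" by blast
      have "p j < v" if "j \<ge> i" for j
        using that
      proof (induction rule: int_ge_induct)
        case (step j)
        have "\<not> v < p (j + 1)"
          using s[OF pV, of j] v step.IH by (auto simp: p_Suc consecutive_def disjoint_iff)
        moreover have "v \<noteq> p (j + 1)" using nv by blast
        ultimately show ?case by simp
      qed (rule i)
      then have "p ` {i..} \<subseteq> V \<inter> {p i..v}"
        using pV mono by (auto simp: strict_mono_less_eq less_imp_le)
      then have "finite (p ` {i..})" using finite_interval finite_subset by blast
      then have "finite {i..}" using inj by (metis finite_imageD inj_on_subset subset_UNIV)
      then show False using infinite_Ici by blast
    next
      case False
      then have "p ` {..0} \<subseteq> V \<inter> {v..p 0}"
        using pV mono by (auto simp: strict_mono_less_eq not_less)
      then have "finite (p ` {..0})" using finite_interval finite_subset by blast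
      then have "finite {..0::int}" using inj by (metis finite_imageD inj_on_subset subset_UNIV)
      then show False using infinite_Iic by blast
    qed
  qed
  then show ?thesis using mono pV by blast
qed

text \<open>Replaces enumerations by the order relation, the form in which crossings are easily
  analysed. The existence of an enumeration is what gives the inclusion from right to left.\<close>

lemma nearest_neighbour_edges_eq:
  "nearest_neighbour_edges V = {{a, b} | a b. consecutive V a b}"
proof (intro equalityI subsetI)
  fix e assume "e \<in> nearest_neighbour_edges V"
  then obtain p :: "int \<Rightarrow> real" and i where p: "strict_mono p" "range p = V" "e = {p i, p (i + 1)}"
    unfolding nearest_neighbour_edges_def by blast
  have "consecutive V (p i) (p (i + 1))"
    using p(1) unfolding p(2)[symmetric] consecutive_def by (auto simp: strict_mono_less)
  then show "e \<in> {{a, b} | a b. consecutive V a b}" using p(3) by blast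
next
  fix e assume "e \<in> {{a, b} | a b. consecutive V a b}"
  then obtain a b where ab: "e = {a, b}" "consecutive V a b" by blast
  obtain p :: "int \<Rightarrow> real" where p: "strict_mono p" "range p = V" using enumeration by blast
  obtain i where i: "a = p i" using ab p by (auto simp: consecutive_def)
  have "consecutive V (p i) (p (i + 1))"
    using p(1) unfolding p(2)[symmetric] consecutive_def by (auto simp: strict_mono_less)
  then have "b = p (i + 1)" using ab i consecutive_unique_right by blast
  then show "e \<in> nearest_neighbour_edges V"
    unfolding nearest_neighbour_edges_def using ab i p by blast
qed

end

text \<open>A vertex located at \<open>c\<close> itself counts as lying to the right, which matches
  the half-open windows used as cutsets.\<close>

definition uncrossed :: "real set \<Rightarrow> real set set \<Rightarrow> real \<Rightarrow> bool" where
  "uncrossed V E c \<longleftrightarrow> (\<forall>x\<in>V. \<forall>y\<in>V. x < c \<longrightarrow> c \<le> y \<longrightarrow> {x, y} \<notin> E)"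

section \<open>Cutsets at uncrossed locations\<close>

locale line_graph = line_vertices +
  fixes E :: "real set set"
  assumes uncrossed_above: "\<And>K. \<exists>c>K. uncrossed V E c"
    and uncrossed_below: "\<And>K. \<exists>c<K. uncrossed V E c"
begin

definition E' where "E' = E \<union> nearest_neighbour_edges V"

lemma crossing_edge:
  assumes "uncrossed V E c" "{x, y} \<in> E'" "x \<in> V" "y \<in> V" "x < c" "c \<le> y"
  shows "consecutive V x y"
  using assms unfolding E'_def uncrossed_def nearest_neighbour_edges_eq
  by (auto simp: doubleton_eq_iff consecutive_def)

lemma edge_between_uncrossed:
  assumes "uncrossed V E l" "uncrossed V E r" "w \<in> V" "l \<le> w" "w < r" "y \<in> nbrs V E' w"
  shows "y \<ge> r \<Longrightarrow> consecutive V w y" "y < l \<Longrightarrow> consecutive V y w"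
  using crossing_edge[of r w y] crossing_edge[of l y w] assms
  by (auto simp: nbrs_def insert_commute)

text \<open>Local finiteness needs no degree estimate: between uncrossed locations on its two sides
  a vertex has finitely many candidates for neighbours, and outside them only the adjacent vertices
  remain.\<close>

lemma finite_nbrs:
  assumes "w \<in> V"
  shows "finite (nbrs V E' w)"
proof -
  obtain l r where lr: "uncrossed V E l" "l < w" "uncrossed V E r" "w < r"
    using uncrossed_above uncrossed_below by metis
  obtain a b where ab: "consecutive V a w" "consecutive V w b"
    using assms next_vertex previous_vertex by blast
  have "nbrs V E' w \<subseteq> (V \<inter> {l..r}) \<union> {a, b}"
  proof
    fix y assume y: "y \<in> nbrs V E' w"
    then show "y \<in> (V \<inter> {l..r}) \<union> {a, b}"
      using edge_between_uncrossed[OF lr(1,3) assms _ lr(4) y] lr ab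
        consecutive_unique_left[of V y w a] consecutive_unique_right[of V w y b]
      by (cases "y < l"; cases "y < r") (auto simp: nbrs_def)
  qed
  then show ?thesis using finite_interval finite_subset by blast
qed

text \<open>Several uncrossed locations may lie in the same gap of \<open>V\<close> and share their
  single crossing edge. A vertex between successive locations forces the cutsets to be
  disjoint.\<close>

lemma uncrossed_sequence:
  assumes "v \<in> V"
  shows "\<exists>l r :: nat \<Rightarrow> real. (\<forall>i. uncrossed V E (l i) \<and> uncrossed V E (r i) \<and> l i \<le> v \<and> v < r i) \<and>
    (\<forall>i. \<exists>x\<in>V. r i \<le> x \<and> x < r (Suc i)) \<and> (\<forall>i. \<exists>x\<in>V. l (Suc i) \<le> x \<and> x < l i)"
proof -
  have R: "\<exists>c'. (uncrossed V E c' \<and> v < c') \<and> (\<exists>x\<in>V. c \<le> x \<and> x < c')" for c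
  proof -
    obtain x where "x \<in> V" "max c v < x" using unbounded_above by blast
    moreover obtain c' where "uncrossed V E c'" "x < c'" using uncrossed_above by blast
    ultimately show ?thesis by (intro exI[of _ c']) (auto intro!: bexI[of _ x])
  qed
  have L: "\<exists>c'. (uncrossed V E c' \<and> c' \<le> v) \<and> (\<exists>x\<in>V. c' \<le> x \<and> x < c)" for c
  proof -
    obtain x where "x \<in> V" "x < min c v" using unbounded_below by blast
    moreover obtain c' where "uncrossed V E c'" "c' < x" using uncrossed_below by blast
    ultimately show ?thesis by (intro exI[of _ c']) (auto intro!: bexI[of _ x])
  qed
  obtain r where "\<forall>i. uncrossed V E (r i) \<and> v < r i" "\<forall>i::nat. \<exists>x\<in>V. r i \<le> x \<and> x < r (Suc i)"
    using dependent_nat_choice[of "\<lambda>_ c. uncrossed V E c \<and> v < c" "\<lambda>_ c c'. \<exists>x\<in>V. c \<le> x \<and> x < c'"] R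
    by metis
  moreover obtain l where "\<forall>i. uncrossed V E (l i) \<and> l i \<le> v" "\<forall>i::nat. \<exists>x\<in>V. l (Suc i) \<le> x \<and> x < l i"
    using dependent_nat_choice[of "\<lambda>_ c. uncrossed V E c \<and> c \<le> v" "\<lambda>_ c c'. \<exists>x\<in>V. c' \<le> x \<and> x < c"] L
    by metis
  ultimately show ?thesis by blast
qed

text \<open>The windows \<open>B i\<close> between the cuts \<open>l i\<close> and
  \<open>r i\<close> have boundaries of at most two pairs, one on each side, and these boundaries
  are disjoint. Nash-Williams with \<open>k\<close> of them inside \<open>B k\<close> gives
  resistance at least \<open>k / 4\<close>.\<close>

lemma eff_resistance_infinity_eq:
  assumes v: "v \<in> V"
  shows "eff_resistance_infinity V E' v = \<infinity>"
proof -
  obtain l r where cut: "\<And>i. uncrossed V E (l i)" "\<And>i. uncrossed V E (r i)"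
      "\<And>i. l i \<le> v" "\<And>i. v < r i"
    and r_step: "\<And>i::nat. \<exists>x\<in>V. r i \<le> x \<and> x < r (Suc i)"
    and l_step: "\<And>i::nat. \<exists>x\<in>V. l (Suc i) \<le> x \<and> x < l i"
    using uncrossed_sequence[OF v] by metis
  have r_less: "\<exists>x\<in>V. r i \<le> x \<and> x < r j" if "i < j" for i j
    using that
  proof (induction j)
    case (Suc j)
    show ?case
    proof (cases "i = j")
      case False
      then obtain x where "x \<in> V" "r i \<le> x" "x < r j" using Suc by auto
      then show ?thesis using r_step[of j] by (intro bexI[of _ x]) auto
    qed (use r_step[of j] in blast)
  qed simp
  have l_less: "\<exists>x\<in>V. l j \<le> x \<and> x < l i" if "i < j" for i j
    using that
  proof (induction j)
    case (Suc j)
    show ?case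
    proof (cases "i = j")
      case False
      then obtain x where "x \<in> V" "l j \<le> x" "x < l i" using Suc by auto
      then show ?thesis using l_step[of j] by (intro bexI[of _ x]) auto
    qed (use l_step[of j] in blast)
  qed simp
  define B where "B i = V \<inter> {l i..<r i}" for i
  have B_mono: "B i \<subseteq> B j" if "i \<le> j" for i j
    using r_less[of i j] l_less[of i j] that by (cases "i = j") (auto simp: B_def)
  have finB: "finite (B i)" for i
    unfolding B_def by (rule finite_subset[OF _ finite_interval[of "l i" "r i"]]) auto
  have bound: "eff_resistance_infinity V E' v \<ge> ennreal (real k / 4)" for k
  proof -
    interpret finite_network V E' v "B k"
      using finB cut v finite_nbrs by unfold_locales (auto simp: B_def)
    have bd: "(consecutive V w y \<and> w < r i \<and> r i \<le> y) \<or> (consecutive V y w \<and> y < l i \<and> l i \<le> w)"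
      if "(w, y) \<in> edge_boundary (B i)" for w y i
      using that edge_between_uncrossed[OF cut(1) cut(2), of w i i y]
      by (auto simp: edge_boundary_def B_def nbrs_def)
    have "card (edge_boundary (B i)) \<le> 2" for i
    proof -
      obtain a b where ab: "consecutive V a b" "a < r i" "r i \<le> b" using consecutive_around by blast
      obtain a' b' where ab': "consecutive V a' b'" "a' < l i" "l i \<le> b'" using consecutive_around by blast
      have "edge_boundary (B i) \<subseteq> {(a, b), (b', a')}"
      proof (rule subrelI)
        fix w y assume "(w, y) \<in> edge_boundary (B i)"
        then consider "consecutive V w y" "w < r i" "r i \<le> y" | "consecutive V y w" "y < l i" "l i \<le> w"
          using bd by blast
        then show "(w, y) \<in> {(a, b), (b', a')}"
        proof cases
          case 1
          then show ?thesis using consecutive_unique_gap[OF 1(1) ab(1), of "r i"] ab by simp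
        next
          case 2
          then show ?thesis using consecutive_unique_gap[OF 2(1) ab'(1), of "l i"] ab' by simp
        qed
      qed
      then have "card (edge_boundary (B i)) \<le> card {(a, b), (b', a')}" by (intro card_mono) auto
      also have "\<dots> \<le> 2" by (simp add: card_insert_if)
      finally show ?thesis .
    qed
    moreover have "edge_boundary (B i) \<inter> edge_boundary (B j) = {}" if "i < j" for i j
    proof -
      have False if 1: "(w, y) \<in> edge_boundary (B i)" and 2: "(w, y) \<in> edge_boundary (B j)" for w y
      proof -
        obtain x x' where x: "x \<in> V" "r i \<le> x" "x < r j" and x': "x' \<in> V" "l j \<le> x'" "x' < l i"
          using r_less l_less \<open>i < j\<close> by metis
        have y: "y \<in> V" "\<not> (l j \<le> y \<and> y < r j)"
          using 2 by (auto simp: edge_boundary_def nbrs_def B_def)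
        from bd[OF 1] show False
        proof (elim disjE conjE)
          \<comment> \<open>As \<open>y\<close> lies outside \<open>B j\<close> too, the pair
            reaches from below \<open>r i\<close> to \<open>r j\<close> or beyond and would enclose
            the vertex \<open>x\<close>.\<close>
          assume "consecutive V w y" "w < r i" "r i \<le> y"
          moreover from this have "r j \<le> y" using y(2) cut(3)[of j] cut(4)[of i] by linarith
          ultimately show False using x unfolding consecutive_def disjoint_iff by force
        next
          assume "consecutive V y w" "y < l i" "l i \<le> w"
          moreover from this have "y < l j" using y(2) cut(3)[of i] cut(4)[of j] by linarith
          ultimately show False using x' unfolding consecutive_def disjoint_iff by force
        qed
      qed
      then show ?thesis by auto
    qed
    then have "disjoint_family_on (\<lambda>i. edge_boundary (B i)) {..<k}"
      unfolding disjoint_family_on_def by (metis Int_commute linorder_neqE_nat)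
    moreover have "v \<in> B i" for i using v cut by (simp add: B_def)
    ultimately have "ennreal (real k / (2 * real 2)) \<le> eff_resistance V E' v (B k)"
      using B_mono by (intro eff_resistance_ge[of k B 2]) (simp_all del: of_nat_numeral)
    also have "\<dots> \<le> eff_resistance_infinity V E' v"
      unfolding eff_resistance_infinity_def using finite_K K_subset v_in_K by (intro SUP_upper) auto
    finally show ?thesis by simp
  qed
  show ?thesis
  proof (rule ccontr)
    assume "eff_resistance_infinity V E' v \<noteq> \<infinity>"
    then obtain t where t: "t \<ge> 0" "eff_resistance_infinity V E' v = ennreal t"
      by (cases "eff_resistance_infinity V E' v") auto
    obtain k where "4 * t < real k" using reals_Archimedean2 by blast
    then show False using bound[of k] t by simp
  qed
qed

text \<open>The nearest-neighbour path alone already joins all vertices, so the unique infinite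
  component is \<open>V\<close> itself.\<close>

lemma components: "graph_components V E' = {V}"
proof -
  obtain p :: "int \<Rightarrow> real" where p: "strict_mono p" "range p = V" using enumeration by blast
  define R where "R = {(v, w). v \<in> V \<and> w \<in> nbrs V E' v}"
  have "{p i, p (i + 1)} \<in> E'" for i
    unfolding E'_def nearest_neighbour_edges_def using p by blast
  then have step: "(p i, p (i + 1)) \<in> R" for i
    unfolding R_def using p strict_mono_less[OF p(1), of i "i + 1"] by (auto simp: nbrs_def)
  have "sym R" unfolding R_def by (rule symI) (auto simp: nbrs_def insert_commute)
  then have sym: "sym (R\<^sup>*)" by (rule sym_rtrancl)
  have up: "(p i, p j) \<in> R\<^sup>*" if "i \<le> j" for i j
    using that by (induction rule: int_ge_induct) (auto intro: rtrancl_into_rtrancl step)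
  have "(p i, p j) \<in> R\<^sup>*" for i j
    using up[of i j] up[of j i] sym by (cases "i \<le> j") (auto dest: symD)
  then have all: "(x, y) \<in> R\<^sup>*" if "x \<in> V" "y \<in> V" for x y
    using that p(2) by auto
  have "y \<in> V" if "(x, y) \<in> R\<^sup>*" "x \<in> V" for x y
    using that by (induction rule: rtrancl_induct) (auto simp: R_def nbrs_def)
  then have "R\<^sup>* `` {x} = V" if "x \<in> V" for x using all that by auto
  moreover have "V \<noteq> {}" using p by auto
  ultimately show ?thesis
    unfolding graph_components_def R_def[symmetric] quotient_def by auto
qed

lemma infinite_vertices: "infinite V"
proof -
  obtain p :: "int \<Rightarrow> real" where p: "strict_mono p" "range p = V" using enumeration by blast
  show ?thesis
  proof
    assume "finite V"
    then have "finite (p ` UNIV)" using p(2) by simp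
    then have "finite (UNIV :: int set)"
      using strict_mono_imp_inj_on[OF p(1)] by (rule finite_imageD)
    then show False using infinite_UNIV_int by simp
  qed
qed

theorem recurrent:
  "recurrent_graph V E' \<and>
    (\<exists>C. {C' \<in> graph_components V E'. infinite C'} = {C} \<and> recurrent_component V E' C)"
proof -
  have "recurrent_component V E' V"
    unfolding recurrent_component_def by (simp add: finite_nbrs eff_resistance_infinity_eq)
  then show ?thesis
    unfolding recurrent_graph_def components
    by (intro conjI exI[of _ V]) (use infinite_vertices in auto)
qed

end

section \<open>Counts of the Poisson process\<close>

lemma poisson_mean_sums: "(\<lambda>k. real k * (exp (- \<mu>) * \<mu> ^ k / fact k)) sums \<mu>" for \<mu> :: real
proof -
  have "(\<lambda>k. \<mu> * exp (- \<mu>) * (\<mu> ^ k / fact k)) sums (\<mu> * exp (- \<mu>) * exp \<mu>)"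
    using exp_converges[of \<mu>] by (intro sums_mult) (simp add: field_simps)
  also have "\<mu> * exp (- \<mu>) * exp \<mu> = \<mu>" by (simp add: exp_minus)
  also have "(\<lambda>k. \<mu> * exp (- \<mu>) * (\<mu> ^ k / fact k)) = (\<lambda>k. real (Suc k) * (exp (- \<mu>) * \<mu> ^ Suc k / fact (Suc k)))"
    by (rule ext) (simp add: field_simps del: of_nat_Suc)
  finally show ?thesis
    using sums_Suc[of "\<lambda>k. real k * (exp (- \<mu>) * \<mu> ^ k / fact k)" \<mu>] by (simp del: of_nat_Suc)
qed

context prob_space
begin

lemma poisson_process_indep:
  assumes "poisson_process lam V" "\<And>n. B n \<in> sets borel" "\<And>n. bounded (B n)" "disjoint_family B"
  shows "indep_vars (\<lambda>_. count_space UNIV) (\<lambda>n \<omega>. card (V \<omega> \<inter> B n)) (UNIV :: nat set)"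
  using assms unfolding poisson_process_def by blast

text \<open>Measurability of a count is part of \<open>indep_vars\<close>, so it is read off the
  sequence consisting of \<open>B\<close> followed by empty sets.\<close>

lemma poisson_process_count_measurable:
  assumes "poisson_process lam V" "B \<in> sets borel" "bounded B"
  shows "(\<lambda>\<omega>. card (V \<omega> \<inter> B)) \<in> measurable M (count_space UNIV)"
proof -
  have "indep_vars (\<lambda>_. count_space UNIV) (\<lambda>n \<omega>. card (V \<omega> \<inter> (if n = 0 then B else {}))) (UNIV :: nat set)"
    by (rule poisson_process_indep[OF assms(1)]) (auto simp: assms disjoint_family_on_def)
  then have "random_variable (count_space UNIV) (\<lambda>\<omega>. card (V \<omega> \<inter> (if (0::nat) = 0 then B else {})))"
    unfolding indep_vars_def by blast
  then show ?thesis by simp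
qed

lemma poisson_process_prob:
  assumes "poisson_process lam V" "B \<in> sets borel" "bounded B"
  shows "prob {\<omega> \<in> space M. card (V \<omega> \<inter> B) = k} =
    exp (- (lam * measure lborel B)) * (lam * measure lborel B) ^ k / fact k"
  using assms unfolding poisson_process_def by blast

lemma poisson_process_mean:
  assumes pp: "poisson_process lam V" and B: "B \<in> sets borel" "bounded B" and "lam \<ge> 0"
  shows "(\<integral>\<^sup>+\<omega>. of_nat (card (V \<omega> \<inter> B)) \<partial>M) = ennreal (lam * measure lborel B)"
proof -
  note [measurable] = poisson_process_count_measurable[OF pp B]
  let ?c = "\<lambda>\<omega>. card (V \<omega> \<inter> B)" and ?\<mu> = "lam * measure lborel B"
  have \<mu>: "0 \<le> ?\<mu>" using \<open>lam \<ge> 0\<close> by simp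
  have "(\<integral>\<^sup>+\<omega>. of_nat (?c \<omega>) \<partial>M) =
      (\<integral>\<^sup>+\<omega>. (\<Sum>k. of_nat k * indicator {\<omega> \<in> space M. ?c \<omega> = k} \<omega>) \<partial>M)"
  proof (intro nn_integral_cong)
    fix \<omega> assume "\<omega> \<in> space M"
    then have "(\<Sum>k. of_nat k * indicator {\<omega> \<in> space M. ?c \<omega> = k} \<omega> :: ennreal) =
        (\<Sum>k\<in>{?c \<omega>}. of_nat k * indicator {\<omega> \<in> space M. ?c \<omega> = k} \<omega>)"
      by (intro suminf_finite) auto
    also have "\<dots> = of_nat (?c \<omega>)" using \<open>\<omega> \<in> space M\<close> by simp
    finally show "of_nat (?c \<omega>) = (\<Sum>k. of_nat k * indicator {\<omega> \<in> space M. ?c \<omega> = k} \<omega> :: ennreal)" ..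
  qed
  also have "\<dots> = (\<Sum>k. \<integral>\<^sup>+\<omega>. of_nat k * indicator {\<omega> \<in> space M. ?c \<omega> = k} \<omega> \<partial>M)"
    by (rule nn_integral_suminf) measurable
  also have "\<dots> = (\<Sum>k. ennreal (real k * (exp (- ?\<mu>) * ?\<mu> ^ k / fact k)))"
    using \<mu> by (intro suminf_cong)
      (simp add: nn_integral_cmult emeasure_eq_measure poisson_process_prob[OF pp B]
        ennreal_of_nat_eq_real_of_nat ennreal_mult[symmetric])
  also have "\<dots> = ennreal ?\<mu>"
    using poisson_mean_sums[of ?\<mu>] \<mu> by (intro suminf_ennreal_eq) auto
  finally show ?thesis .
qed

lemma poisson_process_nn_integral:
  fixes f :: "nat \<Rightarrow> nat \<Rightarrow> ennreal"
  assumes "poisson_process lam V" "\<And>n. B n \<in> sets borel" "\<And>n. bounded (B n)" "disjoint_family B"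
    and "finite I"
  shows "(\<integral>\<^sup>+\<omega>. (\<Prod>n\<in>I. f n (card (V \<omega> \<inter> B n))) \<partial>M) =
    (\<Prod>n\<in>I. \<integral>\<^sup>+\<omega>. f n (card (V \<omega> \<inter> B n)) \<partial>M)"
proof (rule indep_vars_nn_integral[OF \<open>finite I\<close>])
  have "indep_vars (\<lambda>_. borel) (\<lambda>n \<omega>. f n (card (V \<omega> \<inter> B n))) UNIV"
    by (rule indep_vars_compose2[OF poisson_process_indep[OF assms(1-4)]]) auto
  then show "indep_vars (\<lambda>_. borel) (\<lambda>n \<omega>. f n (card (V \<omega> \<inter> B n))) I"
    by (rule indep_vars_subset) simp
qed simp

lemma poisson_process_void:
  assumes pp: "poisson_process lam V" and B: "B \<in> sets borel" "bounded B"
  shows "(\<integral>\<^sup>+\<omega>. of_bool (card (V \<omega> \<inter> B) = 0) \<partial>M) = ennreal (exp (- (lam * measure lborel B)))"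
proof -
  note [measurable] = poisson_process_count_measurable[OF pp B]
  have "(\<integral>\<^sup>+\<omega>. of_bool (card (V \<omega> \<inter> B) = 0) \<partial>M) = (\<integral>\<^sup>+\<omega>. indicator {\<omega> \<in> space M. card (V \<omega> \<inter> B) = 0} \<omega> \<partial>M)"
    by (intro nn_integral_cong) (auto simp: indicator_def)
  also have "\<dots> = emeasure M {\<omega> \<in> space M. card (V \<omega> \<inter> B) = 0}"
    by (rule nn_integral_indicator) measurable
  finally show ?thesis by (simp add: emeasure_eq_measure poisson_process_prob[OF pp B])
qed

lemma poisson_process_void_count:
  assumes pp: "poisson_process lam V" and "lam \<ge> 0"
    and G: "G \<in> sets borel" "bounded G" and A: "A \<in> sets borel" "bounded A"
    and disj: "G \<inter> A = {}"
  shows "(\<integral>\<^sup>+\<omega>. of_bool (card (V \<omega> \<inter> G) = 0) * of_nat (card (V \<omega> \<inter> A)) \<partial>M) =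
    ennreal (exp (- (lam * measure lborel G)) * (lam * measure lborel A))"
proof -
  \<comment> \<open>Independence is formulated for sequences of sets, hence the padding with empty
    sets.\<close>
  let ?B = "\<lambda>n::nat. if n = 0 then G else if n = 1 then A else {}"
  let ?f = "\<lambda>n k. if n = 0 then of_bool (k = 0) else of_nat k :: ennreal"
  have "(\<integral>\<^sup>+\<omega>. (\<Prod>n\<in>{0, 1}. ?f n (card (V \<omega> \<inter> ?B n))) \<partial>M) =
    (\<Prod>n\<in>{0, 1}. \<integral>\<^sup>+\<omega>. ?f n (card (V \<omega> \<inter> ?B n)) \<partial>M)"
    by (rule poisson_process_nn_integral[OF pp])
      (use G A disj in \<open>auto simp: disjoint_family_on_def\<close>)
  then show ?thesis
    using \<open>lam \<ge> 0\<close>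
    by (simp add: poisson_process_void[OF pp G] poisson_process_mean[OF pp A] ennreal_mult)
qed

lemma poisson_process_void_count2:
  assumes pp: "poisson_process lam V" and "lam \<ge> 0"
    and G: "G \<in> sets borel" "bounded G" and A: "A \<in> sets borel" "bounded A"
    and C: "C \<in> sets borel" "bounded C"
    and disj: "G \<inter> A = {}" "G \<inter> C = {}" "A \<inter> C = {}"
  shows "(\<integral>\<^sup>+\<omega>. of_bool (card (V \<omega> \<inter> G) = 0) *
      (of_nat (card (V \<omega> \<inter> A)) * of_nat (card (V \<omega> \<inter> C))) \<partial>M) =
    ennreal (exp (- (lam * measure lborel G)) * ((lam * measure lborel A) * (lam * measure lborel C)))"
proof -
  let ?B = "\<lambda>n::nat. if n = 0 then G else if n = 1 then A else if n = 2 then C else {}"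
  let ?f = "\<lambda>n k. if n = 0 then of_bool (k = 0) else of_nat k :: ennreal"
  have "(\<integral>\<^sup>+\<omega>. (\<Prod>n\<in>{0, 1, 2}. ?f n (card (V \<omega> \<inter> ?B n))) \<partial>M) =
    (\<Prod>n\<in>{0, 1, 2}. \<integral>\<^sup>+\<omega>. ?f n (card (V \<omega> \<inter> ?B n)) \<partial>M)"
    by (rule poisson_process_nn_integral[OF pp])
      (use G A C disj in \<open>auto simp: disjoint_family_on_def\<close>)
  then show ?thesis
    using \<open>lam \<ge> 0\<close>
    by (simp add: poisson_process_void[OF pp G] poisson_process_mean[OF pp A]
        poisson_process_mean[OF pp C] ennreal_mult)
qed

end

text \<open>Passes from the random set to its enumeration: injectivity prevents multiple counting,
  and finiteness excludes the value 0 that \<open>card\<close> takes on infinite sets.\<close>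

lemma count_eq_suminf:
  assumes "inj x" "finite (range x \<inter> A)"
  shows "of_nat (card (range x \<inter> A)) = (\<Sum>n. indicator A (x n) :: ennreal)"
proof -
  have eq: "x ` {n. x n \<in> A} = range x \<inter> A" by auto
  have fin: "finite {n. x n \<in> A}"
    using assms eq by (metis finite_imageD inj_on_subset subset_UNIV)
  have "(\<Sum>n. indicator A (x n) :: ennreal) = (\<Sum>n\<in>{n. x n \<in> A}. indicator A (x n))"
    by (rule suminf_finite[OF fin]) auto
  also have "\<dots> = of_nat (card {n. x n \<in> A})" by simp
  also have "card {n. x n \<in> A} = card (range x \<inter> A)"
    unfolding eq[symmetric] using assms(1) by (intro card_image[symmetric]) (auto intro: inj_on_subset)
  finally show ?thesis ..
qed

section \<open>A product bound for the connection probability\<close>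

text \<open>The three hypotheses say exactly that 0, \<gamma> * \<delta> - 1 and (\<gamma> +
  \<alpha>) * \<delta> - 2 all lie strictly below \<delta> - 2. The room between their maximum
  \<open>\<kappa>0\<close> and \<delta> - 2 is divided to obtain strict inequalities for all
  exponents.\<close>

lemma kernel_exponents:
  fixes \<alpha> \<gamma> \<delta> :: real
  assumes "\<delta> > 2" "\<gamma> < 1 - 1 / \<delta>" "\<alpha> < 1 - \<gamma>"
  obtains \<theta> \<zeta> \<kappa> where "\<theta> > 0" "\<zeta> > 1" "0 \<le> \<kappa>" "\<kappa> < \<delta> - 2"
    "\<gamma> * \<delta> + \<theta> - 1 \<le> \<kappa> / \<zeta>" "(\<gamma> + \<alpha>) * \<delta> + 2 * \<theta> - 2 \<le> \<kappa> / \<zeta>"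
proof -
  define \<kappa>0 where "\<kappa>0 = max 0 (max (\<gamma> * \<delta> - 1) ((\<gamma> + \<alpha>) * \<delta> - 2))"
  have "\<gamma> * \<delta> < \<delta> - 1" using assms(1,2) by (simp add: field_simps)
  moreover have "(\<gamma> + \<alpha>) * \<delta> < \<delta>" using assms(1,3) mult_strict_right_mono[of "\<gamma> + \<alpha>" 1 \<delta>] by simp
  ultimately have less: "\<kappa>0 < \<delta> - 2" using assms(1) by (simp add: \<kappa>0_def)
  have nonneg: "0 \<le> \<kappa>0" by (simp add: \<kappa>0_def)
  \<comment> \<open>\<open>\<kappa>1\<close>, the midpoint of \<open>\<kappa>0\<close> and \<delta>
    - 2, plays the role of \<kappa> / \<zeta>. Then \<theta> takes half of
    \<open>\<kappa>1 - \<kappa>0\<close>, since it enters the second inequality twice, and \<zeta>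
    is such that \<kappa> = \<open>\<zeta> * \<kappa>1\<close> is the midpoint of
    \<open>\<kappa>1\<close> and \<delta> - 2.\<close>
  define \<kappa>1 where "\<kappa>1 = (\<kappa>0 + (\<delta> - 2)) / 2"
  have \<kappa>1: "\<kappa>0 < \<kappa>1" "\<kappa>1 < \<delta> - 2" using less by (auto simp: \<kappa>1_def)
  define \<theta> where "\<theta> = (\<kappa>1 - \<kappa>0) / 2"
  define \<zeta> where "\<zeta> = (\<kappa>1 + (\<delta> - 2)) / (2 * \<kappa>1)"
  have "\<zeta> > 1" using \<kappa>1 nonneg by (simp add: \<zeta>_def field_simps)
  have eq: "\<zeta> * \<kappa>1 / \<zeta> = \<kappa>1" using \<open>\<zeta> > 1\<close> by simp
  have "\<zeta> * \<kappa>1 = (\<kappa>1 + (\<delta> - 2)) / 2" using \<kappa>1 nonneg by (simp add: \<zeta>_def)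
  then have "\<zeta> * \<kappa>1 < \<delta> - 2" "0 \<le> \<zeta> * \<kappa>1" using \<kappa>1 nonneg by auto
  moreover have "\<theta> > 0" using \<kappa>1 by (simp add: \<theta>_def)
  moreover have "\<gamma> * \<delta> - 1 \<le> \<kappa>0" "(\<gamma> + \<alpha>) * \<delta> - 2 \<le> \<kappa>0" unfolding \<kappa>0_def by (simp_all only: max.coboundedI1 max.coboundedI2 order_refl)
  then have "\<gamma> * \<delta> + \<theta> - 1 \<le> \<kappa>1" "(\<gamma> + \<alpha>) * \<delta> + 2 * \<theta> - 2 \<le> \<kappa>1"
    using \<kappa>1 by (auto simp: \<theta>_def field_simps)
  ultimately show ?thesis using that[of \<theta> \<zeta> "\<zeta> * \<kappa>1"] \<open>\<zeta> > 1\<close> eq by simp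
qed

text \<open>The singular power of the smaller mark \<open>s\<close> is divided in two: an integrable
  part with exponent \<theta> - 1 is kept, and a part with exponent - \<kappa> / \<zeta> is traded
  for \<open>x powr \<kappa>\<close> through the truncation. The distance factor pays for
  that.\<close>

lemma profile_kernel_bound_ordered:
  fixes s t x y r :: real
  assumes s: "0 < s" "s \<le> t" "t < 1" and xy: "0 < x" "0 < y" "x + y \<le> r"
    and trunc: "x powr - \<zeta> \<le> s"
    and "\<delta> > 2" "\<zeta> > 1" "0 \<le> \<kappa>" "\<kappa> < \<delta> - 2"
      "\<gamma> * \<delta> + \<theta> - 1 \<le> \<kappa> / \<zeta>" "(\<gamma> + \<alpha>) * \<delta> + 2 * \<theta> - 2 \<le> \<kappa> / \<zeta>"
    and \<tau>: "\<tau> = (\<delta> - \<kappa>) / 2"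
  shows "(s powr \<gamma> * t powr \<alpha> * r) powr - \<delta> \<le>
    s powr (\<theta> - 1) * t powr (\<theta> - 1) * (x powr - \<tau> * y powr - \<tau>)"
proof -
  \<comment> \<open>\<open>a\<close> and \<open>b\<close> are the exponents left over for
    \<open>s\<close> and \<open>t\<close>. \<open>b\<close> may be negative, but \<open>a\<close>
    and \<open>a + b\<close> are not, so \<open>s \<le> t < 1\<close> bounds the left-over factor by
    1.\<close>
  define a where "a = \<kappa> / \<zeta> + 1 - \<theta> - \<gamma> * \<delta>"
  define b where "b = 1 - \<theta> - \<alpha> * \<delta>"
  have a: "0 \<le> a" and ab: "0 \<le> a + b"
    using assms by (auto simp: a_def b_def algebra_simps)
  have "s powr a * t powr b \<le> t powr a * t powr b"
    using s a by (intro mult_right_mono powr_mono2) auto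
  also have "\<dots> = t powr (a + b)" by (simp add: powr_add)
  also have "\<dots> \<le> 1" using s ab powr_mono2[of "a + b" t 1] by simp
  finally have one: "s powr a * t powr b \<le> 1" .
  have "s powr - (\<gamma> * \<delta>) * t powr - (\<alpha> * \<delta>) =
      (s powr (\<theta> - 1) * t powr (\<theta> - 1) * s powr - (\<kappa> / \<zeta>)) * (s powr a * t powr b)"
  proof -
    have "s powr - (\<gamma> * \<delta>) = s powr (\<theta> - 1) * s powr - (\<kappa> / \<zeta>) * s powr a"
      by (simp add: a_def flip: powr_add)
    moreover have "t powr - (\<alpha> * \<delta>) = t powr (\<theta> - 1) * t powr b"
      by (simp add: b_def flip: powr_add)
    ultimately show ?thesis by (simp only: mult_ac)
  qed
  also have "\<dots> \<le> s powr (\<theta> - 1) * t powr (\<theta> - 1) * s powr - (\<kappa> / \<zeta>)"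
    using one by (intro mult_left_le) auto
  also have "s powr - (\<kappa> / \<zeta>) \<le> x powr \<kappa>"
  proof -
    have "s powr - (\<kappa> / \<zeta>) \<le> (x powr - \<zeta>) powr - (\<kappa> / \<zeta>)"
      using trunc xy assms by (intro powr_mono2') auto
    also have "\<dots> = x powr \<kappa>" using \<open>\<zeta> > 1\<close> by (simp add: powr_powr)
    finally show ?thesis .
  qed
  finally have mark: "s powr - (\<gamma> * \<delta>) * t powr - (\<alpha> * \<delta>) \<le>
      s powr (\<theta> - 1) * t powr (\<theta> - 1) * x powr \<kappa>" by (simp add: mult_left_mono)
  \<comment> \<open>\<delta> = (\<kappa> + \<tau>) + \<tau>, and \<open>r\<close> exceeds both
    \<open>x\<close> and \<open>y\<close>; the surplus \<kappa> goes to the end point with the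
    smaller mark.\<close>
  have dist: "r powr - \<delta> \<le> x powr - (\<kappa> + \<tau>) * y powr - \<tau>"
  proof -
    have "r powr - \<delta> = r powr - (\<kappa> + \<tau>) * r powr - \<tau>"
    proof -
      have "- \<delta> = - (\<kappa> + \<tau>) + - \<tau>" using \<tau> by simp
      then show ?thesis by (simp only: powr_add)
    qed
    also have "\<dots> \<le> x powr - (\<kappa> + \<tau>) * y powr - \<tau>"
      using xy assms by (intro mult_mono powr_mono2') auto
    finally show ?thesis .
  qed
  have "(s powr \<gamma> * t powr \<alpha> * r) powr - \<delta> = (s powr - (\<gamma> * \<delta>) * t powr - (\<alpha> * \<delta>)) * r powr - \<delta>"
    using s xy by (simp add: powr_mult powr_powr)
  also have "\<dots> \<le> (s powr (\<theta> - 1) * t powr (\<theta> - 1) * x powr \<kappa>) * (x powr - (\<kappa> + \<tau>) * y powr - \<tau>)"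
    by (rule mult_mono[OF mark dist]) auto
  also have "\<dots> = s powr (\<theta> - 1) * t powr (\<theta> - 1) * ((x powr \<kappa> * x powr - (\<kappa> + \<tau>)) * y powr - \<tau>)"
    by (simp add: mult_ac)
  also have "x powr \<kappa> * x powr - (\<kappa> + \<tau>) = x powr - \<tau>" by (simp add: powr_add[symmetric])
  finally show ?thesis .
qed

text \<open>Either end point may carry the smaller mark, which is why both marks are truncated; the
  case \<open>t < s\<close> is the ordered one with the ends exchanged.\<close>

lemma profile_kernel_bound:
  fixes s t x y r :: real
  assumes "s \<in> {0<..<1}" "t \<in> {0<..<1}" "0 < x" "0 < y" "x + y \<le> r"
    and "x powr - \<zeta> \<le> s" "y powr - \<zeta> \<le> t"
    and "\<delta> > 2" "\<zeta> > 1" "0 \<le> \<kappa>" "\<kappa> < \<delta> - 2"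
      "\<gamma> * \<delta> + \<theta> - 1 \<le> \<kappa> / \<zeta>" "(\<gamma> + \<alpha>) * \<delta> + 2 * \<theta> - 2 \<le> \<kappa> / \<zeta>"
    and "\<tau> = (\<delta> - \<kappa>) / 2"
  shows "(min s t powr \<gamma> * max s t powr \<alpha> * r) powr - \<delta> \<le>
    s powr (\<theta> - 1) * t powr (\<theta> - 1) * (x powr - \<tau> * y powr - \<tau>)"
proof (cases "s \<le> t")
  case True
  then show ?thesis
    using profile_kernel_bound_ordered[OF _ True _ assms(3-6) assms(8-14)] assms(1,2)
    by (simp add: min_absorb1 max_absorb2)
next
  case False
  then show ?thesis
    using profile_kernel_bound_ordered[of t s y x r, OF _ _ _ assms(4,3) _ assms(7-14)] assms(1,2,5)
    by (simp add: min_absorb2 max_absorb1 mult_ac add.commute)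
qed

section \<open>Marks and edges\<close>

text \<open>\<open>P\<close> is not assumed measurable, so its failure is enclosed in events. Their
  intersection for \<open>\<eta> = 1 / (n + 1)\<close> is a null set.\<close>

lemma (in prob_space) AE_small_exception:
  assumes "\<And>\<eta>. \<eta> > 0 \<Longrightarrow> \<exists>T\<in>events. prob T \<le> \<eta> \<and> (AE \<omega> in M. \<omega> \<notin> T \<longrightarrow> P \<omega>)"
  shows "AE \<omega> in M. P \<omega>"
proof -
  have "\<exists>T\<in>events. prob T \<le> 1 / real (Suc n) \<and> (AE \<omega> in M. \<omega> \<notin> T \<longrightarrow> P \<omega>)" for n
    by (rule assms) (simp del: of_nat_Suc)
  then obtain T where T: "\<And>n. T n \<in> events" "\<And>n. prob (T n) \<le> 1 / real (Suc n)"
      "\<And>n. AE \<omega> in M. \<omega> \<notin> T n \<longrightarrow> P \<omega>" by metis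
  have ev: "(\<Inter>n. T n) \<in> events" using T(1) by (intro sets.countable_INT) auto
  have "prob (\<Inter>n. T n) \<le> 0"
  proof (rule LIMSEQ_le_const[OF LIMSEQ_inverse_real_of_nat])
    show "\<exists>N. \<forall>n\<ge>N. prob (\<Inter>n. T n) \<le> inverse (real (Suc n))"
    proof (intro exI allI impI)
      fix n
      have "prob (\<Inter>n. T n) \<le> prob (T n)" using T(1) by (intro finite_measure_mono) auto
      then show "prob (\<Inter>n. T n) \<le> inverse (real (Suc n))" using T(2)[of n]
        by (simp add: inverse_eq_divide del: of_nat_Suc)
    qed
  qed
  then have "(\<Inter>n. T n) \<in> null_sets M"
    using ev by (intro null_setsI) (simp_all add: emeasure_eq_measure measure_le_0_iff)
  then have "AE \<omega> in M. \<omega> \<notin> (\<Inter>n. T n)" by (rule AE_not_in)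
  moreover have "AE \<omega> in M. \<forall>n. \<omega> \<notin> T n \<longrightarrow> P \<omega>" unfolding AE_all_countable using T(3) by blast
  ultimately show ?thesis by eventually_elim auto
qed

section \<open>Integrals over independent uniform marks\<close>

abbreviation unif :: "real measure" where
  "unif \<equiv> uniform_measure lborel {0<..<1}"

lemma prob_space_unif: "prob_space unif"
  by (rule prob_space_uniform_measure) auto

lemma nn_integral_unif_component:
  assumes "w \<in> borel_measurable borel"
  shows "(\<integral>\<^sup>+u. w (u i) \<partial>Pi\<^sub>M (UNIV :: nat set) (\<lambda>_. unif)) = (\<integral>\<^sup>+s. w s \<partial>unif)"
proof -
  have "(\<integral>\<^sup>+s. w s \<partial>unif) = (\<integral>\<^sup>+s. w s \<partial>distr (Pi\<^sub>M (UNIV :: nat set) (\<lambda>_. unif)) unif (\<lambda>u. u i))"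
    by (subst distr_PiM_component[of UNIV "\<lambda>_. unif" i]) (auto simp: prob_space_unif)
  also have "\<dots> = (\<integral>\<^sup>+u. w (u i) \<partial>Pi\<^sub>M (UNIV :: nat set) (\<lambda>_. unif))"
    using assms by (intro nn_integral_distr measurable_component_singleton) simp_all
  finally show ?thesis ..
qed

lemma nn_integral_unif_two_components:
  assumes w[measurable]: "w \<in> borel_measurable borel" and "i \<noteq> j"
  shows "(\<integral>\<^sup>+u. w (u i) * w (u j) \<partial>Pi\<^sub>M (UNIV :: nat set) (\<lambda>_. unif)) = (\<integral>\<^sup>+s. w s \<partial>unif) * (\<integral>\<^sup>+s. w s \<partial>unif)"
proof -
  interpret unif: prob_space unif by (rule prob_space_unif)
  interpret P: product_prob_space "\<lambda>_::nat. unif" UNIV by unfold_locales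
  have w': "w \<in> borel_measurable unif" using w by simp
  have "(\<integral>\<^sup>+u. w (u i) * w (u j) \<partial>Pi\<^sub>M UNIV (\<lambda>_. unif)) =
      (\<integral>\<^sup>+u. (\<Prod>k\<in>{i, j}. w (restrict u {i, j} k)) \<partial>Pi\<^sub>M (UNIV :: nat set) (\<lambda>_. unif))"
    using \<open>i \<noteq> j\<close> by simp
  also have "\<dots> = (\<integral>\<^sup>+u. (\<Prod>k\<in>{i, j}. w (u k))
      \<partial>distr (Pi\<^sub>M (UNIV :: nat set) (\<lambda>_. unif)) (Pi\<^sub>M {i, j} (\<lambda>_. unif)) (\<lambda>u. restrict u {i, j}))"
    using w' by (intro nn_integral_distr[symmetric] measurable_restrict_subset) auto
  also have "distr (Pi\<^sub>M (UNIV :: nat set) (\<lambda>_. unif)) (Pi\<^sub>M {i, j} (\<lambda>_. unif)) (\<lambda>u. restrict u {i, j}) =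
      Pi\<^sub>M {i, j} (\<lambda>_. unif)"
    by (rule P.distr_PiM_restrict_finite) auto
  also have "(\<integral>\<^sup>+u. (\<Prod>k\<in>{i, j}. w (u k)) \<partial>Pi\<^sub>M {i, j} (\<lambda>_. unif)) = (\<Prod>k\<in>{i, j}. \<integral>\<^sup>+s. w s \<partial>unif)"
    using w' by (intro P.product_nn_integral_prod) auto
  finally show ?thesis using \<open>i \<noteq> j\<close> by simp
qed

lemma nn_integral_unif_powr:
  assumes "\<theta> > 0"
  shows "(\<integral>\<^sup>+s. ennreal (s powr (\<theta> - 1)) \<partial>unif) < \<infinity>"
proof -
  have "((\<lambda>s. s powr (\<theta> - 1)) has_integral (1 powr (\<theta> - 1 + 1) / (\<theta> - 1 + 1))) {0..1::real}"
    using assms by (intro has_integral_powr_from_0) auto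
  then have "((\<lambda>s. if s \<in> {0..1} then s powr (\<theta> - 1) else 0) has_integral (1 / \<theta>)) UNIV"
    by (simp only: has_integral_restrict_UNIV) simp
  also have "(\<lambda>s. if s \<in> {0..1} then s powr (\<theta> - 1) else 0) = (\<lambda>s::real. indicator {0..1} s * s powr (\<theta> - 1))"
    by (rule ext) simp
  finally have "(\<integral>\<^sup>+s. ennreal (indicator {0..1} s * s powr (\<theta> - 1)) \<partial>lborel) = ennreal (1 / \<theta>)"
    by (intro nn_integral_has_integral_lborel) simp_all
  moreover have "(\<integral>\<^sup>+s. ennreal (s powr (\<theta> - 1)) \<partial>unif) =
      (\<integral>\<^sup>+s. ennreal (s powr (\<theta> - 1)) * indicator {0<..<1} s \<partial>lborel)"
    by (subst nn_integral_uniform_measure) (auto simp: divide_ennreal_def)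
  moreover have "\<dots> \<le> (\<integral>\<^sup>+s. ennreal (indicator {0..1} s * s powr (\<theta> - 1)) \<partial>lborel)"
    by (intro nn_integral_mono) (auto simp: indicator_def)
  ultimately show ?thesis by (metis ennreal_less_top infinity_ennreal_def order_le_less_trans)
qed

lemma emeasure_unif_lessThan: "emeasure unif {..<h} \<le> ennreal h"
proof (cases "h \<le> 0")
  case True
  then have "{0<..<1} \<inter> {..<h} = ({} :: real set)" by auto
  then show ?thesis by (simp add: emeasure_uniform_measure)
next
  case False
  have "emeasure unif {..<h} = emeasure lborel ({0<..<1} \<inter> {..<h})"
    by (simp add: emeasure_uniform_measure divide_ennreal_def)
  also have "\<dots> \<le> emeasure lborel {0<..<h}" by (intro emeasure_mono) auto
  also have "\<dots> = ennreal h" using False by simp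
  finally show ?thesis .
qed

section \<open>Joint law of locations, marks and edges\<close>

context wdrcm
begin

abbreviation points :: "'w \<Rightarrow> nat \<Rightarrow> 'a" where "points \<omega> \<equiv> \<lambda>n. X n \<omega>"
abbreviation mark :: "'w \<Rightarrow> nat \<Rightarrow> real" where "mark \<omega> \<equiv> \<lambda>n. U n \<omega>"

lemma measurable_points [measurable]: "points \<in> measurable M (Pi\<^sub>M UNIV (\<lambda>_. borel))"
  by (rule measurable_PiM_single') (auto simp: X_measurable)

lemma measurable_mark [measurable]: "mark \<in> measurable M (Pi\<^sub>M UNIV (\<lambda>_. borel))"
  by (rule measurable_PiM_single') (auto simp: U_measurable)

lemma sets_marks: "sets (Pi\<^sub>M (UNIV :: nat set) (\<lambda>_. unif)) = sets (Pi\<^sub>M UNIV (\<lambda>_. borel))"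
  by (rule sets_PiM_cong) auto

lemma nn_integral_points_marks:
  assumes \<phi>[measurable]: "\<phi> \<in> borel_measurable (Pi\<^sub>M UNIV (\<lambda>_. borel))"
    and \<psi>[measurable]: "\<psi> \<in> borel_measurable (Pi\<^sub>M UNIV (\<lambda>_. borel))"
  shows "(\<integral>\<^sup>+\<omega>. \<phi> (points \<omega>) * \<psi> (mark \<omega>) \<partial>M) =
    (\<integral>\<^sup>+\<omega>. \<phi> (points \<omega>) \<partial>M) * (\<integral>\<^sup>+u. \<psi> u \<partial>Pi\<^sub>M (UNIV :: nat set) (\<lambda>_. unif))"
proof -
  let ?D = "distr M (Pi\<^sub>M UNIV (\<lambda>_. borel)) points"
  let ?P = "Pi\<^sub>M (UNIV :: nat set) (\<lambda>_. unif)"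
  interpret P: prob_space ?P by (rule prob_space_PiM) (rule prob_space_unif)
  have \<psi>': "\<psi> \<in> borel_measurable ?P"
    using \<psi> measurable_cong_sets[OF sets_marks refl] by blast
  have "(\<integral>\<^sup>+\<omega>. \<phi> (points \<omega>) * \<psi> (mark \<omega>) \<partial>M) =
      (\<integral>\<^sup>+z. \<phi> (fst z) * \<psi> (snd z) \<partial>distr M (Pi\<^sub>M UNIV (\<lambda>_. borel) \<Otimes>\<^sub>M Pi\<^sub>M UNIV (\<lambda>_. borel))
        (\<lambda>\<omega>. (points \<omega>, mark \<omega>)))"
    by (subst nn_integral_distr) auto
  also have "\<dots> = (\<integral>\<^sup>+z. \<phi> (fst z) * \<psi> (snd z) \<partial>(?D \<Otimes>\<^sub>M ?P))"
    unfolding marks ..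
  also have "\<dots> = (\<integral>\<^sup>+x. \<integral>\<^sup>+u. \<phi> x * \<psi> u \<partial>?P \<partial>?D)"
  proof (subst P.nn_integral_fst[symmetric])
    show "(\<lambda>z. \<phi> (fst z) * \<psi> (snd z)) \<in> borel_measurable (?D \<Otimes>\<^sub>M ?P)"
      using \<phi> \<psi>' by (intro borel_measurable_times_ennreal measurable_compose[OF measurable_fst] measurable_compose[OF measurable_snd]) auto
  qed simp
  also have "\<dots> = (\<integral>\<^sup>+x. \<phi> x * (\<integral>\<^sup>+u. \<psi> u \<partial>?P) \<partial>?D)"
    by (simp add: nn_integral_cmult \<psi>')
  also have "\<dots> = (\<integral>\<^sup>+x. \<phi> x \<partial>?D) * (\<integral>\<^sup>+u. \<psi> u \<partial>?P)"
    by (rule nn_integral_multc) simp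
  also have "(\<integral>\<^sup>+x. \<phi> x \<partial>?D) = (\<integral>\<^sup>+\<omega>. \<phi> (points \<omega>) \<partial>M)"
    by (rule nn_integral_distr) auto
  finally show ?thesis .
qed

lemma AE_marks_in_unit_interval: "AE \<omega> in M. \<forall>i. U i \<omega> \<in> {0<..<1}"
proof -
  have "AE \<omega> in M. U i \<omega> \<in> {0<..<1}" for i
  proof -
    have [measurable]: "(\<lambda>u :: nat \<Rightarrow> real. indicator (- {0<..<1}) (u i) :: ennreal) \<in> borel_measurable (Pi\<^sub>M UNIV (\<lambda>_. borel))"
      by measurable
    have "(\<integral>\<^sup>+\<omega>. indicator (- {0<..<1}) (U i \<omega>) \<partial>M) =
        (\<integral>\<^sup>+u. indicator (- {0<..<1}) (u i) \<partial>Pi\<^sub>M (UNIV :: nat set) (\<lambda>_. unif))"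
      using nn_integral_points_marks[of "\<lambda>_. 1" "\<lambda>u. indicator (- {0<..<1}) (u i)"]
      by (simp add: emeasure_space_1)
    also have "\<dots> = (\<integral>\<^sup>+s. indicator (- {0<..<1}) s \<partial>unif)"
      by (rule nn_integral_unif_component[of "indicator (- {0<..<1})"]) auto
    also have "\<dots> = 0" by (simp add: emeasure_uniform_measure)
    finally have "AE \<omega> in M. indicator (- {0<..<1}) (U i \<omega>) = (0 :: ennreal)"
      using U_measurable[of i] by (subst (asm) nn_integral_0_iff_AE) auto
    then show ?thesis by eventually_elim (auto simp: indicator_def split: if_splits)
  qed
  then show ?thesis by (simp add: AE_all_countable)
qed

lemma AE_locally_finite: "AE \<omega> in M. \<forall>B. bounded B \<longrightarrow> finite (range (points \<omega>) \<inter> B)"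
  using vertices unfolding poisson_process_def by blast

lemma edge_event': "i \<noteq> j \<Longrightarrow> {\<omega> \<in> space M. {X i \<omega>, X j \<omega>} \<in> E \<omega>} \<in> events"
  using edge_event[of i j] edge_event[of j i] by (cases "i < j") (auto simp: insert_commute)

text \<open>\<open>T\<close> restricts locations and marks only, so integrating the conditional edge
  probability over it gives the probability of \<open>T\<close> together with the edge. A bound
  \<open>q\<close> valid on \<open>T\<close> suffices, and that is where mark truncation is
  available.\<close>

lemma emeasure_edge_le:
  assumes "i < j" and T: "T \<in> sets (Pi\<^sub>M UNIV (\<lambda>_. borel) \<Otimes>\<^sub>M Pi\<^sub>M UNIV (\<lambda>_. borel))"
    and q: "AE \<omega> in M. (points \<omega>, mark \<omega>) \<in> T \<longrightarrow>
      ennreal (rho (g (U i \<omega>) (U j \<omega>) * norm (X i \<omega> - X j \<omega>) ^ DIM('a))) \<le> q \<omega>"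
  shows "emeasure M {\<omega> \<in> space M. (points \<omega>, mark \<omega>) \<in> T \<and> {X i \<omega>, X j \<omega>} \<in> E \<omega>} \<le>
    (\<integral>\<^sup>+\<omega>. indicator T (points \<omega>, mark \<omega>) * q \<omega> \<partial>M)"
proof -
  let ?N = "Pi\<^sub>M (UNIV :: nat set) (\<lambda>_. borel :: 'a measure) \<Otimes>\<^sub>M Pi\<^sub>M (UNIV :: nat set) (\<lambda>_. borel :: real measure)"
  define F where "F = vimage_algebra (space M) (\<lambda>\<omega>. (points \<omega>, mark \<omega>)) ?N"
  define ev where "ev = {\<omega> \<in> space M. {X i \<omega>, X j \<omega>} \<in> E \<omega>}"
  define S where "S = (\<lambda>\<omega>. (points \<omega>, mark \<omega>)) -` T \<inter> space M"
  have Z[measurable]: "(\<lambda>\<omega>. (points \<omega>, mark \<omega>)) \<in> measurable M ?N" by measurable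
  have subalg: "subalgebra M F"
    unfolding subalgebra_def F_def
    using measurable_sets[OF Z] measurable_space[OF Z] by (auto simp: sets_vimage_algebra2)
  interpret F: finite_measure_subalgebra M F by unfold_locales (rule subalg)
  \<comment> \<open>As a preimage of \<open>T\<close>, \<open>S\<close> belongs to the conditioning
    algebra, so the edge indicator and its conditional expectation have the same integral over
    \<open>S\<close>.\<close>
  have SF: "S \<in> sets F" unfolding S_def F_def using T by (rule in_vimage_algebra)
  then have [measurable]: "S \<in> events" using subalg by (auto simp: subalgebra_def)
  have [measurable]: "ev \<in> events" unfolding ev_def using \<open>i < j\<close> by (rule edge_event)
  let ?c = "real_cond_exp M F (indicator ev)"
  have int: "integrable M (indicator ev :: 'w \<Rightarrow> real)"
    by (intro integrable_real_indicator) (simp_all add: emeasure_eq_measure)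
  have c: "AE \<omega> in M. ?c \<omega> = rho (g (U i \<omega>) (U j \<omega>) * norm (X i \<omega> - X j \<omega>) ^ DIM('a))"
    using edges[of "{(i, j)}"] \<open>i < j\<close> by (simp add: F_def ev_def)
  have pos: "AE \<omega> in M. 0 \<le> ?c \<omega>" by (rule F.real_cond_exp_pos) auto
  have intc: "integrable M ?c" by (rule F.real_cond_exp_int(1)[OF int])
  have "emeasure M (S \<inter> ev) = ennreal (\<integral>\<omega>\<in>S. indicator ev \<omega> \<partial>M)"
    by (simp add: emeasure_eq_measure set_lebesgue_integral_def indicator_inter_arith[symmetric])
  also have "\<dots> = ennreal (\<integral>\<omega>\<in>S. ?c \<omega> \<partial>M)"
    using F.real_cond_exp_intA[OF int SF] by simp
  also have "\<dots> = (\<integral>\<^sup>+\<omega>. ennreal (indicator S \<omega> * ?c \<omega>) \<partial>M)"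
    unfolding set_lebesgue_integral_def real_scaleR_def
    using pos by (intro nn_integral_eq_integral[symmetric] integrable_mult_indicator[where 'b=real, simplified] intc) auto
  also have "\<dots> \<le> (\<integral>\<^sup>+\<omega>. indicator T (points \<omega>, mark \<omega>) * q \<omega> \<partial>M)"
    using c q by (intro nn_integral_mono_AE, eventually_elim) (auto simp: S_def indicator_def)
  finally show ?thesis
    by (simp add: S_def ev_def Int_def conj_ac cong: conj_cong)
qed

end

text \<open>Void events and counts are phrased on sequences instead of random sets, so that they are
  measurable for the product algebra on which \<open>marks\<close> gives independence of locations
  and marks.\<close>

definition avoiding :: "'a set \<Rightarrow> (nat \<Rightarrow> 'a) set" where
  "avoiding G = {x. \<forall>n. x n \<notin> G}"

definition point_count :: "'a set \<Rightarrow> (nat \<Rightarrow> 'a) \<Rightarrow> ennreal" where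
  "point_count A x = (\<Sum>n. indicator A (x n))"

lemma avoiding_sets [measurable]:
  assumes [measurable]: "G \<in> sets borel"
  shows "avoiding G \<in> sets (Pi\<^sub>M (UNIV :: nat set) (\<lambda>_. borel))"
proof -
  have "{x \<in> space (Pi\<^sub>M (UNIV :: nat set) (\<lambda>_. borel)). \<forall>n. x n \<notin> G} \<in> sets (Pi\<^sub>M UNIV (\<lambda>_. borel))"
    by measurable
  then show ?thesis by (simp add: avoiding_def space_PiM)
qed

lemma point_count_measurable [measurable]:
  assumes [measurable]: "A \<in> sets borel"
  shows "point_count A \<in> borel_measurable (Pi\<^sub>M (UNIV :: nat set) (\<lambda>_. borel))"
  unfolding point_count_def[abs_def] by measurable

context wdrcm
begin

lemma AE_point_count:
  assumes "bounded A"
  shows "AE \<omega> in M. point_count A (points \<omega>) = of_nat (card (range (points \<omega>) \<inter> A))"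
  using AE_locally_finite X_distinct
  by eventually_elim (simp add: point_count_def count_eq_suminf assms)

text \<open>Boundedness makes the intersection finite almost surely; on an infinite one
  \<open>card\<close> would be 0 as well.\<close>

lemma AE_avoiding:
  assumes "bounded G"
  shows "AE \<omega> in M. points \<omega> \<in> avoiding G \<longleftrightarrow> card (range (points \<omega>) \<inter> G) = 0"
  using AE_locally_finite
proof eventually_elim
  case (elim \<omega>)
  then have "card (range (points \<omega>) \<inter> G) = 0 \<longleftrightarrow> range (points \<omega>) \<inter> G = {}"
    using assms by simp
  then show ?case by (auto simp: avoiding_def)
qed

lemma void_count:
  assumes G: "G \<in> sets borel" "bounded G" and A: "A \<in> sets borel" "bounded A" and "G \<inter> A = {}"
  shows "(\<integral>\<^sup>+\<omega>. indicator (avoiding G) (points \<omega>) * point_count A (points \<omega>) \<partial>M) =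
    ennreal (exp (- (lam * measure lborel G)) * (lam * measure lborel A))"
proof -
  have "(\<integral>\<^sup>+\<omega>. indicator (avoiding G) (points \<omega>) * point_count A (points \<omega>) \<partial>M) =
    (\<integral>\<^sup>+\<omega>. of_bool (card (range (points \<omega>) \<inter> G) = 0) * of_nat (card (range (points \<omega>) \<inter> A)) \<partial>M)"
    using AE_avoiding[OF G(2)] AE_point_count[OF A(2)]
    by (intro nn_integral_cong_AE, eventually_elim) (simp add: indicator_def)
  also have "\<dots> = ennreal (exp (- (lam * measure lborel G)) * (lam * measure lborel A))"
    using assms intensity by (intro poisson_process_void_count[OF vertices]) auto
  finally show ?thesis .
qed

lemma void_count2:
  assumes G: "G \<in> sets borel" "bounded G" and A: "A \<in> sets borel" "bounded A"
    and C: "C \<in> sets borel" "bounded C" and "G \<inter> A = {}" "G \<inter> C = {}" "A \<inter> C = {}"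
  shows "(\<integral>\<^sup>+\<omega>. indicator (avoiding G) (points \<omega>) * (point_count A (points \<omega>) * point_count C (points \<omega>)) \<partial>M) =
    ennreal (exp (- (lam * measure lborel G)) * ((lam * measure lborel A) * (lam * measure lborel C)))"
proof -
  have "(\<integral>\<^sup>+\<omega>. indicator (avoiding G) (points \<omega>) * (point_count A (points \<omega>) * point_count C (points \<omega>)) \<partial>M) =
    (\<integral>\<^sup>+\<omega>. of_bool (card (range (points \<omega>) \<inter> G) = 0) *
      (of_nat (card (range (points \<omega>) \<inter> A)) * of_nat (card (range (points \<omega>) \<inter> C))) \<partial>M)"
    using AE_avoiding[OF G(2)] AE_point_count[OF A(2)] AE_point_count[OF C(2)]
    by (intro nn_integral_cong_AE, eventually_elim) (simp add: indicator_def)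
  also have "\<dots> = ennreal (exp (- (lam * measure lborel G)) * ((lam * measure lborel A) * (lam * measure lborel C)))"
    using assms intensity by (intro poisson_process_void_count2[OF vertices]) auto
  finally show ?thesis .
qed

text \<open>Union bound over indices: each mark is independent of the locations and contributes a
  factor of at most \<open>h\<close>, and the location terms sum to the mean count on the void
  event. The void probability of \<open>G\<close> survives as a factor.\<close>

lemma small_mark_prob:
  assumes G: "G \<in> sets borel" "bounded G" and A: "A \<in> sets borel" "bounded A" and "G \<inter> A = {}"
  shows "{\<omega> \<in> space M. points \<omega> \<in> avoiding G \<and> (\<exists>i. X i \<omega> \<in> A \<and> U i \<omega> < h)} \<in> events"
      (is "?L \<in> events")
    and "emeasure M {\<omega> \<in> space M. points \<omega> \<in> avoiding G \<and> (\<exists>i. X i \<omega> \<in> A \<and> U i \<omega> < h)} \<le>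
    ennreal (exp (- (lam * measure lborel G)) * (lam * measure lborel A)) * ennreal h"
proof -
  note [measurable] = G(1) A(1) U_measurable X_measurable
  let ?\<phi> = "\<lambda>i x. indicator (avoiding G) x * indicator A (x i) :: ennreal"
  let ?S = "\<lambda>i. {\<omega> \<in> space M. points \<omega> \<in> avoiding G \<and> X i \<omega> \<in> A \<and> U i \<omega> < h}"
  have S: "?S i \<in> events" for i by measurable
  have one: "emeasure M (?S i) \<le> (\<integral>\<^sup>+\<omega>. ?\<phi> i (points \<omega>) \<partial>M) * ennreal h" for i
  proof -
    have "emeasure M (?S i) = (\<integral>\<^sup>+\<omega>. indicator (?S i) \<omega> \<partial>M)"
      by (rule nn_integral_indicator[symmetric]) measurable
    also have "\<dots> = (\<integral>\<^sup>+\<omega>. ?\<phi> i (points \<omega>) * indicator {..<h} (mark \<omega> i) \<partial>M)"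
      by (intro nn_integral_cong) (auto simp: indicator_def)
    also have "\<dots> = (\<integral>\<^sup>+\<omega>. ?\<phi> i (points \<omega>) \<partial>M) * (\<integral>\<^sup>+u. indicator {..<h} (u i) \<partial>Pi\<^sub>M (UNIV :: nat set) (\<lambda>_. unif))"
      by (rule nn_integral_points_marks) measurable
    also have "(\<integral>\<^sup>+u. indicator {..<h} (u i) \<partial>Pi\<^sub>M (UNIV :: nat set) (\<lambda>_. unif)) = emeasure unif {..<h}"
      by (subst nn_integral_unif_component) auto
    also have "(\<integral>\<^sup>+\<omega>. ?\<phi> i (points \<omega>) \<partial>M) * emeasure unif {..<h} \<le> (\<integral>\<^sup>+\<omega>. ?\<phi> i (points \<omega>) \<partial>M) * ennreal h"
      by (intro mult_left_mono emeasure_unif_lessThan) simp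
    finally show ?thesis .
  qed
  show "?L \<in> events" by measurable
  have "emeasure M ?L = emeasure M (\<Union>i. ?S i)"
    by (intro arg_cong[where f="emeasure M"]) auto
  also have "\<dots> \<le> (\<Sum>i. emeasure M (?S i))"
    using S by (intro emeasure_subadditive_countably) blast
  also have "\<dots> \<le> (\<Sum>i. (\<integral>\<^sup>+\<omega>. ?\<phi> i (points \<omega>) \<partial>M) * ennreal h)"
    by (intro suminf_le one) auto
  also have "\<dots> = (\<Sum>i. \<integral>\<^sup>+\<omega>. ?\<phi> i (points \<omega>) \<partial>M) * ennreal h" by simp
  also have "(\<Sum>i. \<integral>\<^sup>+\<omega>. ?\<phi> i (points \<omega>) \<partial>M) = (\<integral>\<^sup>+\<omega>. (\<Sum>i. ?\<phi> i (points \<omega>)) \<partial>M)"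
    by (rule nn_integral_suminf[symmetric]) measurable
  also have "\<dots> = (\<integral>\<^sup>+\<omega>. indicator (avoiding G) (points \<omega>) * point_count A (points \<omega>) \<partial>M)"
    by (simp add: point_count_def)
  also have "\<dots> = ennreal (exp (- (lam * measure lborel G)) * (lam * measure lborel A))"
    by (rule void_count[OF assms])
  finally show "emeasure M ?L \<le> ennreal (exp (- (lam * measure lborel G)) * (lam * measure lborel A)) * ennreal h" .
qed

text \<open>Edges are listed with \<open>i < j\<close>, but the order of indices says nothing about
  which end point lies to the left; symmetry of \<open>g\<close> covers both orders.\<close>

lemma emeasure_edge_le':
  assumes "i \<noteq> j" and T: "T \<in> sets (Pi\<^sub>M UNIV (\<lambda>_. borel) \<Otimes>\<^sub>M Pi\<^sub>M UNIV (\<lambda>_. borel))"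
    and sym: "\<And>s t. g s t = g t s"
    and q: "AE \<omega> in M. (points \<omega>, mark \<omega>) \<in> T \<longrightarrow>
      ennreal (rho (g (U i \<omega>) (U j \<omega>) * norm (X i \<omega> - X j \<omega>) ^ DIM('a))) \<le> q \<omega>"
  shows "emeasure M {\<omega> \<in> space M. (points \<omega>, mark \<omega>) \<in> T \<and> {X i \<omega>, X j \<omega>} \<in> E \<omega>} \<le>
    (\<integral>\<^sup>+\<omega>. indicator T (points \<omega>, mark \<omega>) * q \<omega> \<partial>M)"
proof (cases "i < j")
  case True
  then show ?thesis by (rule emeasure_edge_le[OF _ T q])
next
  case False
  have "emeasure M {\<omega> \<in> space M. (points \<omega>, mark \<omega>) \<in> T \<and> {X j \<omega>, X i \<omega>} \<in> E \<omega>} \<le>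
      (\<integral>\<^sup>+\<omega>. indicator T (points \<omega>, mark \<omega>) * q \<omega> \<partial>M)"
    using False \<open>i \<noteq> j\<close> q by (intro emeasure_edge_le[OF _ T]) (simp_all add: sym[of "U j _"] norm_minus_commute)
  then show ?thesis by (simp add: insert_commute)
qed

end

text \<open>All that is used of kernel and profile from here on. The product form of the bound makes
  the expected number of crossing edges factor into a left and a right sum.\<close>

locale line_model = wdrcm M lam rho g X U E
  for M :: "'w measure" and lam rho g and X :: "nat \<Rightarrow> 'w \<Rightarrow> real" and U E +
  fixes \<theta> \<tau> \<zeta> :: real
  assumes exponents: "\<theta> > 0" "\<tau> > 1" "\<zeta> > 1"
    and kernel_sym: "\<And>s t. g s t = g t s"
    and connection_bound: "\<And>s t x y r. s \<in> {0<..<1} \<Longrightarrow> t \<in> {0<..<1} \<Longrightarrow> 0 < x \<Longrightarrow> 0 < y \<Longrightarrow>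
      x + y \<le> r \<Longrightarrow> x powr - \<zeta> \<le> s \<Longrightarrow> y powr - \<zeta> \<le> t \<Longrightarrow>
      rho (g s t * r) \<le> s powr (\<theta> - 1) * t powr (\<theta> - 1) * (x powr - \<tau> * y powr - \<tau>)"
begin

definition mark_moment :: ennreal where
  "mark_moment = (\<integral>\<^sup>+s. ennreal (s powr (\<theta> - 1)) \<partial>unif)"

text \<open>Union bound over pairs of indices. After the connection bound each term splits into a
  location part, whose sum is the mean of the product of two counts on the void event, and two
  independent mark moments.\<close>

lemma long_edges_prob:
  assumes G: "G \<in> sets borel" "bounded G" and A: "A \<in> sets borel" "bounded A"
    and C: "C \<in> sets borel" "bounded C" and disj: "G \<inter> A = {}" "G \<inter> C = {}" "A \<inter> C = {}"
    and xy: "0 < x" "0 < y" and dist: "\<And>v w. v \<in> A \<Longrightarrow> w \<in> C \<Longrightarrow> x + y \<le> \<bar>v - w\<bar>"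
  shows "{\<omega> \<in> space M. points \<omega> \<in> avoiding G \<and> (\<exists>i j. X i \<omega> \<in> A \<and> X j \<omega> \<in> C \<and>
      x powr - \<zeta> \<le> U i \<omega> \<and> y powr - \<zeta> \<le> U j \<omega> \<and> {X i \<omega>, X j \<omega>} \<in> E \<omega>)} \<in> events" (is "?H \<in> events")
    and "emeasure M {\<omega> \<in> space M. points \<omega> \<in> avoiding G \<and> (\<exists>i j. X i \<omega> \<in> A \<and> X j \<omega> \<in> C \<and>
      x powr - \<zeta> \<le> U i \<omega> \<and> y powr - \<zeta> \<le> U j \<omega> \<and> {X i \<omega>, X j \<omega>} \<in> E \<omega>)} \<le>
    ennreal (exp (- (lam * measure lborel G)) * ((lam * measure lborel A) * (lam * measure lborel C))) *
    (mark_moment * mark_moment * ennreal (x powr - \<tau> * y powr - \<tau>))"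
proof -
  note [measurable] = G(1) A(1) C(1) U_measurable X_measurable
  let ?c = "ennreal (x powr - \<tau> * y powr - \<tau>)"
  let ?w = "\<lambda>s. ennreal (s powr (\<theta> - 1))"
  let ?\<phi> = "\<lambda>i j x. indicator (avoiding G) x * (indicator A (x i) * indicator C (x j)) :: ennreal"
  define S where "S i j = {\<omega> \<in> space M. points \<omega> \<in> avoiding G \<and> X i \<omega> \<in> A \<and> X j \<omega> \<in> C \<and>
      x powr - \<zeta> \<le> U i \<omega> \<and> y powr - \<zeta> \<le> U j \<omega> \<and> {X i \<omega>, X j \<omega>} \<in> E \<omega>}" for i j
  let ?PX = "Pi\<^sub>M (UNIV :: nat set) (\<lambda>_. borel :: real measure)"
  let ?N = "?PX \<Otimes>\<^sub>M ?PX"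
  \<comment> \<open>With \<open>i = j\<close> excluded, the two marks are different coordinates and
    their moments multiply.\<close>
  have diag: "S i i = {}" for i using disj by (auto simp: S_def)
  have S: "S i j \<in> events" for i j
  proof (cases "i = j")
    case False
    have "S i j = {\<omega> \<in> space M. points \<omega> \<in> avoiding G \<and> X i \<omega> \<in> A \<and> X j \<omega> \<in> C \<and>
      x powr - \<zeta> \<le> U i \<omega> \<and> y powr - \<zeta> \<le> U j \<omega>} \<inter> {\<omega> \<in> space M. {X i \<omega>, X j \<omega>} \<in> E \<omega>}"
      by (auto simp: S_def)
    moreover have "{\<omega> \<in> space M. points \<omega> \<in> avoiding G \<and> X i \<omega> \<in> A \<and> X j \<omega> \<in> C \<and>
      x powr - \<zeta> \<le> U i \<omega> \<and> y powr - \<zeta> \<le> U j \<omega>} \<in> events" by measurable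
    ultimately show ?thesis using edge_event'[OF False] by (simp only: sets.Int)
  qed (simp add: diag)
  have one: "emeasure M (S i j) \<le> (\<integral>\<^sup>+\<omega>. ?\<phi> i j (points \<omega>) \<partial>M) * (mark_moment * mark_moment * ?c)" for i j
  proof (cases "i = j")
    case False
    define T where "T = {z \<in> space ?N. fst z \<in> avoiding G \<and> fst z i \<in> A \<and> fst z j \<in> C \<and>
      x powr - \<zeta> \<le> snd z i \<and> y powr - \<zeta> \<le> snd z j}"
    have T: "T \<in> sets ?N" unfolding T_def by measurable
    have "S i j = {\<omega> \<in> space M. (points \<omega>, mark \<omega>) \<in> T \<and> {X i \<omega>, X j \<omega>} \<in> E \<omega>}"
      by (auto simp: S_def T_def space_pair_measure space_PiM)
    then have "emeasure M (S i j) = emeasure M {\<omega> \<in> space M. (points \<omega>, mark \<omega>) \<in> T \<and> {X i \<omega>, X j \<omega>} \<in> E \<omega>}"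
      by simp
    also have "\<dots> \<le> (\<integral>\<^sup>+\<omega>. indicator T (points \<omega>, mark \<omega>) * (?w (U i \<omega>) * ?w (U j \<omega>) * ?c) \<partial>M)"
    proof (rule emeasure_edge_le'[OF False T kernel_sym])
      show "AE \<omega> in M. (points \<omega>, mark \<omega>) \<in> T \<longrightarrow>
          ennreal (rho (g (U i \<omega>) (U j \<omega>) * norm (X i \<omega> - X j \<omega>) ^ DIM(real))) \<le>
          ?w (U i \<omega>) * ?w (U j \<omega>) * ?c"
        using AE_marks_in_unit_interval
      proof (eventually_elim, intro impI)
        fix \<omega> assume u: "\<forall>i. U i \<omega> \<in> {0<..<1}" and z: "(points \<omega>, mark \<omega>) \<in> T"
        have "rho (g (U i \<omega>) (U j \<omega>) * \<bar>X i \<omega> - X j \<omega>\<bar>) \<le>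
            U i \<omega> powr (\<theta> - 1) * U j \<omega> powr (\<theta> - 1) * (x powr - \<tau> * y powr - \<tau>)"
          using u z dist xy by (intro connection_bound) (auto simp: T_def)
        then show "ennreal (rho (g (U i \<omega>) (U j \<omega>) * norm (X i \<omega> - X j \<omega>) ^ DIM(real))) \<le>
          ?w (U i \<omega>) * ?w (U j \<omega>) * ?c"
          by (simp add: ennreal_mult[symmetric] ennreal_leI)
      qed
    qed
    \<comment> \<open>The mark truncation has served to bound \<open>rho\<close>; dropping it leaves
      a function of the locations times a function of the marks.\<close>
    also have "\<dots> \<le> (\<integral>\<^sup>+\<omega>. ?\<phi> i j (points \<omega>) * (?w (mark \<omega> i) * ?w (mark \<omega> j) * ?c) \<partial>M)"
      by (intro nn_integral_mono mult_right_mono) (auto simp: T_def indicator_def)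
    also have "\<dots> = (\<integral>\<^sup>+\<omega>. ?\<phi> i j (points \<omega>) \<partial>M) *
        (\<integral>\<^sup>+u. ?w (u i) * ?w (u j) * ?c \<partial>Pi\<^sub>M (UNIV :: nat set) (\<lambda>_. unif))"
      by (rule nn_integral_points_marks) measurable
    also have "(\<integral>\<^sup>+u. ?w (u i) * ?w (u j) * ?c \<partial>Pi\<^sub>M (UNIV :: nat set) (\<lambda>_. unif)) =
        (\<integral>\<^sup>+u. ?w (u i) * ?w (u j) \<partial>Pi\<^sub>M (UNIV :: nat set) (\<lambda>_. unif)) * ?c"
    proof (rule nn_integral_multc)
      have "(\<lambda>u. ?w (u i) * ?w (u j)) \<in> borel_measurable ?PX" by measurable
      then show "(\<lambda>u. ?w (u i) * ?w (u j)) \<in> borel_measurable (Pi\<^sub>M (UNIV :: nat set) (\<lambda>_. unif))"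
        using measurable_cong_sets[OF sets_marks refl] by blast
    qed
    also have "(\<integral>\<^sup>+u. ?w (u i) * ?w (u j) \<partial>Pi\<^sub>M (UNIV :: nat set) (\<lambda>_. unif)) = mark_moment * mark_moment"
      unfolding mark_moment_def by (rule nn_integral_unif_two_components[OF _ False]) measurable
    finally show ?thesis .
  qed (simp add: diag)
  have H: "?H = (\<Union>i. \<Union>j. S i j)" by (auto simp: S_def)
  show "?H \<in> events" unfolding H using S by auto
  have "emeasure M ?H = emeasure M (\<Union>i. \<Union>j. S i j)" unfolding H ..
  also have "\<dots> \<le> (\<Sum>i. emeasure M (\<Union>j. S i j))"
    using S by (intro emeasure_subadditive_countably) auto
  also have "\<dots> \<le> (\<Sum>i. \<Sum>j. emeasure M (S i j))"
    using S by (intro suminf_le emeasure_subadditive_countably) auto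
  also have "\<dots> \<le> (\<Sum>i. \<Sum>j. (\<integral>\<^sup>+\<omega>. ?\<phi> i j (points \<omega>) \<partial>M) * (mark_moment * mark_moment * ?c))"
    by (intro suminf_le one) auto
  also have "\<dots> = (\<Sum>i. \<Sum>j. \<integral>\<^sup>+\<omega>. ?\<phi> i j (points \<omega>) \<partial>M) * (mark_moment * mark_moment * ?c)" by simp
  also have "(\<Sum>i. \<Sum>j. \<integral>\<^sup>+\<omega>. ?\<phi> i j (points \<omega>) \<partial>M) = (\<integral>\<^sup>+\<omega>. (\<Sum>i. \<Sum>j. ?\<phi> i j (points \<omega>)) \<partial>M)"
  proof -
    have [measurable]: "(\<lambda>\<omega>. ?\<phi> i j (points \<omega>)) \<in> borel_measurable M" for i j by measurable
    have "(\<Sum>i. \<Sum>j. \<integral>\<^sup>+\<omega>. ?\<phi> i j (points \<omega>) \<partial>M) = (\<Sum>i. \<integral>\<^sup>+\<omega>. (\<Sum>j. ?\<phi> i j (points \<omega>)) \<partial>M)"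
      by (intro suminf_cong nn_integral_suminf[symmetric]) measurable
    also have "\<dots> = (\<integral>\<^sup>+\<omega>. (\<Sum>i. \<Sum>j. ?\<phi> i j (points \<omega>)) \<partial>M)"
      by (rule nn_integral_suminf[symmetric]) measurable
    finally show ?thesis .
  qed
  also have "\<dots> = (\<integral>\<^sup>+\<omega>. indicator (avoiding G) (points \<omega>) * (point_count A (points \<omega>) * point_count C (points \<omega>)) \<partial>M)"
    by (simp add: point_count_def)
  also have "\<dots> = ennreal (exp (- (lam * measure lborel G)) * ((lam * measure lborel A) * (lam * measure lborel C)))"
    by (rule void_count2[OF G A C disj])
  finally show "emeasure M ?H \<le>
    ennreal (exp (- (lam * measure lborel G)) * ((lam * measure lborel A) * (lam * measure lborel C))) *
    (mark_moment * mark_moment * ennreal (x powr - \<tau> * y powr - \<tau>))" .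
qed

end

section \<open>Uncrossed locations at large gaps\<close>

lemma summable_shifted_powr: "p > 1 \<Longrightarrow> summable (\<lambda>k. real (k + N) powr - p)"
  by (subst summable_iff_shift) (simp add: summable_real_powr_iff)

lemma suminf_tail_tendsto:
  fixes p :: real
  assumes "p > 1"
  shows "(\<lambda>N. \<Sum>k. real (k + N) powr - p) \<longlonglongrightarrow> 0"
proof (rule LIMSEQ_I)
  fix r :: real assume "r > 0"
  have "summable (\<lambda>k. real k powr - p)" using assms by (simp add: summable_real_powr_iff)
  from suminf_exist_split[OF \<open>r > 0\<close> this]
  show "\<exists>no. \<forall>n\<ge>no. norm ((\<Sum>k. real (k + n) powr - p) - 0) < r" by simp
qed

section \<open>Crossing probability at a single gap\<close>

context line_model
begin

definition tail :: "real \<Rightarrow> nat \<Rightarrow> real" where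
  "tail p N = (\<Sum>k. real (k + N) powr - p)"

definition gap :: "real \<Rightarrow> nat \<Rightarrow> real set" where
  "gap a N = {a..<a + 2 * real N}"

text \<open>Bounds the failure probability relative to the void probability. The linear term counts
  too small marks on the two sides; the square is the left sum times the right sum over crossing
  edges.\<close>

definition crossing_rate :: "nat \<Rightarrow> real" where
  "crossing_rate N = 2 * lam * tail \<zeta> N + (lam * enn2real mark_moment * tail \<tau> N)\<^sup>2"

lemma tail_nonneg: "0 \<le> tail p N" if "p > 1"
  unfolding tail_def using that by (intro suminf_nonneg summable_shifted_powr) auto

lemma suminf_ennreal_tail:
  assumes "p > 1"
  shows "(\<Sum>k. ennreal (real (k + N) powr - p)) = ennreal (tail p N)"
  unfolding tail_def using assms by (intro suminf_ennreal2 summable_shifted_powr) auto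

lemma crossing_rate_nonneg: "0 \<le> crossing_rate N"
  unfolding crossing_rate_def using tail_nonneg exponents intensity by simp

lemma crossing_rate_tendsto: "crossing_rate \<longlonglongrightarrow> 0"
proof -
  have "(\<lambda>N. 2 * lam * tail \<zeta> N + (lam * enn2real mark_moment * tail \<tau> N)\<^sup>2) \<longlonglongrightarrow>
      2 * lam * 0 + (lam * enn2real mark_moment * 0)\<^sup>2"
    unfolding tail_def using exponents by (intro tendsto_intros suminf_tail_tendsto)
  then show ?thesis unfolding crossing_rate_def[abs_def] by simp
qed

text \<open>Unit cells on both sides of the gap reduce the estimate to
  \<open>small_mark_prob\<close> and \<open>long_edges_prob\<close>. If the gap is void, an edge
  crossing its left end \<open>a\<close> must cross the whole gap.\<close>

lemma uncrossed_gap: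
  assumes "N > 0"
  shows "\<exists>T\<in>events. prob T \<le> exp (- (lam * (2 * real N))) * crossing_rate N \<and>
    (\<forall>\<omega>\<in>space M. points \<omega> \<in> avoiding (gap a N) \<longrightarrow> \<omega> \<notin> T \<longrightarrow> uncrossed (range (points \<omega>)) (E \<omega>) a)"
proof -
  define G where "G = gap a N"
  \<comment> \<open>Cell \<open>k\<close> on either side is at distance at least
    \<open>d k = k + N\<close> from the midpoint \<open>a + N\<close>, so an edge from
    \<open>A k\<close> to \<open>C l\<close> has length at least \<open>d k + d l\<close>.\<close>
  define A where "A k = {a - real k - 1..<a - real k}" for k :: nat
  define C where "C l = {a + 2 * real N + real l..<a + 2 * real N + real l + 1}" for l :: nat
  define d where "d k = real (k + N)" for k
  define p where "p = exp (- (lam * (2 * real N)))"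
  define low where "low B k = {\<omega> \<in> space M. points \<omega> \<in> avoiding G \<and> (\<exists>i. X i \<omega> \<in> B \<and> U i \<omega> < d k powr - \<zeta>)}" for B k
  define high where "high k l = {\<omega> \<in> space M. points \<omega> \<in> avoiding G \<and> (\<exists>i j. X i \<omega> \<in> A k \<and> X j \<omega> \<in> C l \<and>
      d k powr - \<zeta> \<le> U i \<omega> \<and> d l powr - \<zeta> \<le> U j \<omega> \<and> {X i \<omega>, X j \<omega>} \<in> E \<omega>)}" for k l
  define T where "T = (\<Union>k. low (A k) k) \<union> (\<Union>l. low (C l) l) \<union> (\<Union>k. \<Union>l. high k l)"
  have G: "G \<in> sets borel" "bounded G" "measure lborel G = 2 * real N"
    by (simp_all add: G_def gap_def bounded_subset[OF bounded_closed_interval[of a "a + 2 * real N"]] subset_iff)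
  have A: "A k \<in> sets borel" "bounded (A k)" "measure lborel (A k) = 1" "G \<inter> A k = {}" for k
    by (auto simp: A_def G_def gap_def intro: bounded_subset[OF bounded_closed_interval[of "a - real k - 1" "a - real k"]])
  have C: "C k \<in> sets borel" "bounded (C k)" "measure lborel (C k) = 1" "G \<inter> C k = {}" for k
    by (auto simp: C_def G_def gap_def
        intro: bounded_subset[OF bounded_closed_interval[of "a + 2 * real N + real k" "a + 2 * real N + real k + 1"]])
  have AC: "A k \<inter> C l = {}" for k l by (auto simp: A_def C_def)
  have d: "0 < d k" for k using \<open>N > 0\<close> by (simp add: d_def)
  have dist: "d k + d l \<le> \<bar>v - w\<bar>" if "v \<in> A k" "w \<in> C l" for k l v w
    using that by (simp add: A_def C_def d_def)
  have p: "0 \<le> p" by (simp add: p_def)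
  have low_ev: "low (A k) k \<in> events" "low (C k) k \<in> events" for k
    unfolding low_def using A C G by (auto intro!: small_mark_prob(1))
  have low_le: "emeasure M (low (A k) k) \<le> ennreal (p * lam) * ennreal (d k powr - \<zeta>)"
    "emeasure M (low (C k) k) \<le> ennreal (p * lam) * ennreal (d k powr - \<zeta>)" for k
    unfolding low_def p_def
    using small_mark_prob(2)[OF G(1,2) A(1,2,4), of k "d k powr - \<zeta>"]
      small_mark_prob(2)[OF G(1,2) C(1,2,4), of k "d k powr - \<zeta>"] A(3)[of k] C(3)[of k] G(3)
    by simp_all
  have high_ev: "high k l \<in> events" for k l
    unfolding high_def
    by (rule long_edges_prob(1)[OF G(1,2) A(1,2) C(1,2) A(4) C(4) AC d d dist])
  have high_le: "emeasure M (high k l) \<le> ennreal (p * (lam * lam)) *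
      (mark_moment * mark_moment * ennreal (d k powr - \<tau> * d l powr - \<tau>))" for k l
    using long_edges_prob(2)[OF G(1,2) A(1,2) C(1,2) A(4) C(4) AC d d dist, of k l]
    unfolding high_def p_def A(3) C(3) G(3) by simp
  have T_ev: "T \<in> events"
    unfolding T_def using low_ev high_ev by auto
  \<comment> \<open>Finiteness matters: \<open>enn2real\<close> would turn an infinite moment into
    0, and \<open>crossing_rate\<close> would not be a bound.\<close>
  have mm: "mark_moment = ennreal (enn2real mark_moment)"
    using nn_integral_unif_powr[OF exponents(1)] unfolding mark_moment_def by (simp add: less_top)
  have sum_low: "(\<Sum>k. ennreal (p * lam) * ennreal (d k powr - \<zeta>)) = ennreal (p * lam * tail \<zeta> N)"
    using suminf_ennreal_tail[OF exponents(3), of N] tail_nonneg[OF exponents(3), of N] p intensity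
    by (simp add: d_def ennreal_mult)
  have sum_high: "(\<Sum>k. \<Sum>l. ennreal (p * (lam * lam)) * (mark_moment * mark_moment * ennreal (d k powr - \<tau> * d l powr - \<tau>))) =
      ennreal (p * (lam * enn2real mark_moment * tail \<tau> N)\<^sup>2)"
  proof -
    have "(\<Sum>k. \<Sum>l. ennreal (p * (lam * lam)) * (mark_moment * mark_moment * ennreal (d k powr - \<tau> * d l powr - \<tau>))) =
      ennreal (p * (lam * lam)) * (mark_moment * mark_moment * (ennreal (tail \<tau> N) * ennreal (tail \<tau> N)))"
      by (simp add: ennreal_mult d_def suminf_ennreal_tail[OF exponents(2)] del: of_nat_add)
    also have "\<dots> = ennreal (p * (lam * enn2real mark_moment * tail \<tau> N)\<^sup>2)"
      using p intensity tail_nonneg[OF exponents(2), of N]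
      by (subst (1 2) mm) (simp add: ennreal_mult[symmetric] power2_eq_square mult_ac)
    finally show ?thesis .
  qed
  have "emeasure M T \<le> emeasure M ((\<Union>k. low (A k) k) \<union> (\<Union>l. low (C l) l)) + emeasure M (\<Union>k. \<Union>l. high k l)"
    unfolding T_def using low_ev high_ev by (intro emeasure_subadditive) auto
  also have "\<dots> \<le> (emeasure M (\<Union>k. low (A k) k) + emeasure M (\<Union>l. low (C l) l)) + emeasure M (\<Union>k. \<Union>l. high k l)"
    using low_ev by (intro add_right_mono emeasure_subadditive) auto
  also have "\<dots> \<le> ((\<Sum>k. emeasure M (low (A k) k)) + (\<Sum>l. emeasure M (low (C l) l))) + (\<Sum>k. emeasure M (\<Union>l. high k l))"
    using low_ev high_ev by (intro add_mono emeasure_subadditive_countably) auto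
  also have "\<dots> \<le> (\<Sum>k. ennreal (p * lam) * ennreal (d k powr - \<zeta>)) + (\<Sum>k. ennreal (p * lam) * ennreal (d k powr - \<zeta>)) +
      (\<Sum>k. \<Sum>l. emeasure M (high k l))"
    using low_le high_ev by (intro add_mono suminf_le emeasure_subadditive_countably) auto
  also have "\<dots> \<le> (\<Sum>k. ennreal (p * lam) * ennreal (d k powr - \<zeta>)) + (\<Sum>k. ennreal (p * lam) * ennreal (d k powr - \<zeta>)) +
      (\<Sum>k. \<Sum>l. ennreal (p * (lam * lam)) * (mark_moment * mark_moment * ennreal (d k powr - \<tau> * d l powr - \<tau>)))"
    by (intro add_left_mono suminf_le high_le) auto
  also have "\<dots> = ennreal (p * crossing_rate N)"
    unfolding sum_low sum_high
    using p intensity tail_nonneg[OF exponents(2), of N] tail_nonneg[OF exponents(3), of N]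
    by (simp add: crossing_rate_def ennreal_plus[symmetric] algebra_simps del: ennreal_plus)
  finally have "prob T \<le> p * crossing_rate N"
    using p crossing_rate_nonneg by (simp add: emeasure_eq_measure)
  moreover have "uncrossed (range (points \<omega>)) (E \<omega>) a"
    if \<omega>: "\<omega> \<in> space M" "points \<omega> \<in> avoiding G" "\<omega> \<notin> T" for \<omega>
    unfolding uncrossed_def
  proof (intro ballI impI notI)
    fix x y assume xy: "x \<in> range (points \<omega>)" "y \<in> range (points \<omega>)" "x < a" "a \<le> y" and e: "{x, y} \<in> E \<omega>"
    then obtain i j where ij: "x = X i \<omega>" "y = X j \<omega>" by auto
    have "y \<notin> G" using \<omega>(2) ij by (simp add: avoiding_def)
    then have y: "a + 2 * real N \<le> y" using xy by (simp add: G_def gap_def)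
    \<comment> \<open>Membership in \<open>A k\<close> means \<open>k < a - x \<le> k + 1\<close>,
      hence the ceiling minus 1 here and the floor on the other side.\<close>
    define k where "k = nat (\<lceil>a - x\<rceil> - 1)"
    have "x \<in> A k" using xy unfolding A_def k_def by (simp, linarith)
    define l where "l = nat \<lfloor>y - (a + 2 * real N)\<rfloor>"
    have "y \<in> C l" using y unfolding C_def l_def by (simp, linarith)
    have "\<omega> \<notin> low (A k) k" "\<omega> \<notin> low (C l) l" "\<omega> \<notin> high k l"
      using \<omega>(3) by (auto simp: T_def)
    then show False
      using \<open>x \<in> A k\<close> \<open>y \<in> C l\<close> e \<omega> unfolding low_def high_def ij by (auto simp: not_less)
  qed
  ultimately show ?thesis using T_ev unfolding p_def G_def by blast
qed

text \<open>The gaps are adjacent half-open intervals of equal length, hence disjoint, and the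
  Poisson counts in them are independent.\<close>

lemma no_gap_prob:
  shows "{\<omega> \<in> space M. \<forall>n<K. points \<omega> \<notin> avoiding (gap (m + 2 * real N * real n) N)} \<in> events"
      (is "?S \<in> events")
    and "prob {\<omega> \<in> space M. \<forall>n<K. points \<omega> \<notin> avoiding (gap (m + 2 * real N * real n) N)} =
      (1 - exp (- (lam * (2 * real N)))) ^ K"
proof -
  define G where "G n = gap (m + 2 * real N * real n) N" for n
  define p where "p = exp (- (lam * (2 * real N)))"
  have G: "G n \<in> sets borel" "bounded (G n)" "measure lborel (G n) = 2 * real N" for n
    by (simp_all add: G_def gap_def subset_iff
      bounded_subset[OF bounded_closed_interval[of "m + 2 * real N * real n" "m + 2 * real N * real n + 2 * real N"]])
  note [measurable] = G(1)
  show ev: "?S \<in> events" unfolding G_def[symmetric] by measurable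
  have disj: "disjoint_family G"
  proof -
    have "G i \<inter> G j = {}" if "i < j" for i j
    proof -
      have "2 * real N * (real i + 1) \<le> 2 * real N * real j"
        using that by (intro mult_left_mono) auto
      then show ?thesis by (auto simp: G_def gap_def algebra_simps)
    qed
    then show ?thesis unfolding disjoint_family_on_def by (metis Int_commute linorder_neqE_nat)
  qed
  let ?c = "\<lambda>n \<omega>. card (range (points \<omega>) \<inter> G n)"
  have [measurable]: "?c n \<in> measurable M (count_space UNIV)" for n
    by (rule poisson_process_count_measurable[OF vertices G(1,2)])
  have one: "(\<integral>\<^sup>+\<omega>. of_bool (?c n \<omega> \<noteq> 0) \<partial>M) = ennreal (1 - p)" for n
  proof -
    have "(\<integral>\<^sup>+\<omega>. of_bool (?c n \<omega> \<noteq> 0) \<partial>M) = (\<integral>\<^sup>+\<omega>. indicator (space M - {\<omega> \<in> space M. ?c n \<omega> = 0}) \<omega> \<partial>M)"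
      by (intro nn_integral_cong) (auto simp: indicator_def)
    also have "\<dots> = ennreal (prob (space M - {\<omega> \<in> space M. ?c n \<omega> = 0}))"
      by (subst nn_integral_indicator) (auto simp: emeasure_eq_measure)
    also have "prob (space M - {\<omega> \<in> space M. ?c n \<omega> = 0}) = 1 - p"
      using poisson_process_prob[OF vertices G(1,2), of n 0]
      by (subst prob_compl) (simp_all add: G(3) p_def)
    finally show ?thesis .
  qed
  have "emeasure M ?S = (\<integral>\<^sup>+\<omega>. indicator ?S \<omega> \<partial>M)"
    by (rule nn_integral_indicator[OF ev, symmetric])
  also have "\<dots> = (\<integral>\<^sup>+\<omega>. (\<Prod>n\<in>{..<K}. of_bool (?c n \<omega> \<noteq> 0)) \<partial>M)"
  proof (intro nn_integral_cong_AE)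
    have "AE \<omega> in M. \<forall>n. points \<omega> \<in> avoiding (G n) \<longleftrightarrow> ?c n \<omega> = 0"
      unfolding AE_all_countable using AE_avoiding G(2) by blast
    then show "AE \<omega> in M. indicator ?S \<omega> = (\<Prod>n\<in>{..<K}. of_bool (?c n \<omega> \<noteq> 0) :: ennreal)"
    proof (rule AE_mp, intro AE_I2 impI)
      fix \<omega> assume "\<omega> \<in> space M" and av: "\<forall>n. points \<omega> \<in> avoiding (G n) \<longleftrightarrow> ?c n \<omega> = 0"
      show "indicator ?S \<omega> = (\<Prod>n\<in>{..<K}. of_bool (?c n \<omega> \<noteq> 0) :: ennreal)"
      proof (cases "\<forall>n<K. ?c n \<omega> \<noteq> 0")
        case True
        then have "\<omega> \<in> ?S" using av \<open>\<omega> \<in> space M\<close> unfolding G_def by blast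
        moreover have "(\<Prod>n\<in>{..<K}. of_bool (?c n \<omega> \<noteq> 0) :: ennreal) = 1"
          using True by (intro prod.neutral) simp
        ultimately show ?thesis by (simp only: indicator_simps not_False_eq_True)
      next
        case False
        then obtain n where n: "n < K" "?c n \<omega> = 0" by blast
        then have "\<omega> \<notin> ?S" using av unfolding G_def by blast
        moreover have "(\<Prod>n\<in>{..<K}. of_bool (?c n \<omega> \<noteq> 0) :: ennreal) = 0"
          using n by (intro prod_zero) auto
        ultimately show ?thesis by (simp only: indicator_simps not_False_eq_True)
      qed
    qed
  qed
  also have "\<dots> = (\<Prod>n\<in>{..<K}. \<integral>\<^sup>+\<omega>. of_bool (?c n \<omega> \<noteq> 0) \<partial>M)"
    by (rule poisson_process_nn_integral[OF vertices G(1,2) disj, where f = "\<lambda>_ k. of_bool (k \<noteq> 0)"]) simp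
  also have "\<dots> = ennreal ((1 - p) ^ K)"
    unfolding one using intensity by (simp add: ennreal_power p_def)
  finally have eq: "emeasure M ?S = ennreal ((1 - exp (- (lam * (2 * real N)))) ^ K)" unfolding p_def .
  show "prob ?S = (1 - exp (- (lam * (2 * real N)))) ^ K"
    by (rule measure_eq_emeasure_eq_ennreal[OF _ eq]) (use intensity in simp)
qed

text \<open>The exceptional event collects the case that no gap is void and the exceptional events
  of all single gaps.\<close>

lemma uncrossed_in_grid:
  assumes "N > 0"
  shows "\<exists>T\<in>events. prob T \<le> (1 - exp (- (lam * (2 * real N)))) ^ K +
      real K * (exp (- (lam * (2 * real N))) * crossing_rate N) \<and>
    (\<forall>\<omega>\<in>space M. \<omega> \<notin> T \<longrightarrow> (\<exists>n<K. uncrossed (range (points \<omega>)) (E \<omega>) (m + 2 * real N * real n)))"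
proof -
  define a where "a n = m + 2 * real N * real n" for n
  let ?Q = "\<lambda>n T. T \<in> events \<and> prob T \<le> exp (- (lam * (2 * real N))) * crossing_rate N \<and>
    (\<forall>\<omega>\<in>space M. points \<omega> \<in> avoiding (gap (a n) N) \<longrightarrow> \<omega> \<notin> T \<longrightarrow>
      uncrossed (range (points \<omega>)) (E \<omega>) (a n))"
  have "\<forall>n. \<exists>T. ?Q n T"
  proof
    fix n show "\<exists>T. ?Q n T" using uncrossed_gap[OF assms, of "a n"] unfolding Bex_def .
  qed
  from choice[OF this] obtain T where T0: "\<forall>n. ?Q n (T n)" ..
  have T: "\<And>n. T n \<in> events"
      "\<And>n. prob (T n) \<le> exp (- (lam * (2 * real N))) * crossing_rate N"
      "\<And>n \<omega>. \<omega> \<in> space M \<Longrightarrow> points \<omega> \<in> avoiding (gap (a n) N) \<Longrightarrow> \<omega> \<notin> T n \<Longrightarrow>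
        uncrossed (range (points \<omega>)) (E \<omega>) (a n)"
    using T0 by auto
  define S where "S = {\<omega> \<in> space M. \<forall>n<K. points \<omega> \<notin> avoiding (gap (a n) N)}"
  have S: "S \<in> events" "prob S = (1 - exp (- (lam * (2 * real N)))) ^ K"
    using no_gap_prob[where N = N and K = K and m = m] unfolding S_def a_def by blast+
  have "prob (S \<union> (\<Union>n<K. T n)) \<le> prob S + prob (\<Union>n<K. T n)"
    using S T by (intro measure_Un_le) auto
  also have "prob (\<Union>n<K. T n) \<le> (\<Sum>n<K. prob (T n))"
    using T by (intro finite_measure_subadditive_finite) auto
  also have "\<dots> \<le> (\<Sum>n<K. exp (- (lam * (2 * real N))) * crossing_rate N)"
    by (intro sum_mono T)
  finally have "prob (S \<union> (\<Union>n<K. T n)) \<le> (1 - exp (- (lam * (2 * real N)))) ^ K +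
      real K * (exp (- (lam * (2 * real N))) * crossing_rate N)"
    using S(2) by simp
  moreover have "S \<union> (\<Union>n<K. T n) \<in> events" using S T by auto
  moreover have "\<exists>n<K. uncrossed (range (points \<omega>)) (E \<omega>) (a n)"
    if "\<omega> \<in> space M" "\<omega> \<notin> S \<union> (\<Union>n<K. T n)" for \<omega>
    using that T(3) unfolding S_def by blast
  ultimately show ?thesis unfolding a_def by blast
qed

text \<open>\<open>P\<close> describes a region with room for every finite grid; it is applied to
  half-lines on both sides.\<close>

lemma AE_uncrossed:
  assumes P: "\<And>N K. \<exists>m. \<forall>n<K. P (m + 2 * real N * real n)"
  shows "AE \<omega> in M. \<exists>c. P c \<and> uncrossed (range (points \<omega>)) (E \<omega>) c"
proof (rule AE_small_exception)
  fix \<eta> :: real assume "\<eta> > 0"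
  \<comment> \<open>Makes \<open>exp (- j)\<close> smaller than \<open>\<eta> / 2\<close>, the share
    of the error reserved for the absence of void gaps.\<close>
  obtain j where j: "- ln (\<eta> / 2) < real j" using reals_Archimedean2 by blast
  have "eventually (\<lambda>N. crossing_rate N < \<eta> / (2 * (real j + 1))) sequentially"
    using crossing_rate_tendsto \<open>\<eta> > 0\<close> by (intro order_tendstoD(2)) auto
  then have "eventually (\<lambda>N. crossing_rate N < \<eta> / (2 * (real j + 1)) \<and> N > 0) sequentially"
    using eventually_gt_at_top[of 0] by eventually_elim simp
  then obtain N where N: "crossing_rate N < \<eta> / (2 * (real j + 1))" "N > 0"
    by (auto simp: eventually_sequentially)
  define p where "p = exp (- (lam * (2 * real N)))"
  have p: "0 < p" "p \<le> 1" using intensity by (auto simp: p_def)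
  \<comment> \<open>Rounding up adds at most \<open>p \<le> 1\<close> to \<open>p * real K\<close>,
    which thus lies between \<open>j\<close> and \<open>j + 1\<close>: the lower bound serves
    \<open>(1 - p) ^ K\<close>, the upper one explains the divisor \<open>2 * (real j + 1)\<close>
    in the choice of \<open>N\<close>.\<close>
  define K where "K = nat \<lceil>real j / p\<rceil>"
  have "real j / p \<le> real K" "real K \<le> real j / p + 1"
    using p unfolding K_def by (auto simp: of_nat_nat)
  then have K: "real j \<le> p * real K" "p * real K \<le> real j + 1"
    using p by (auto simp: field_simps)
  obtain m where m: "\<forall>n<K. P (m + 2 * real N * real n)" using P by blast
  obtain T where T: "T \<in> events" "prob T \<le> (1 - p) ^ K + real K * (p * crossing_rate N)"
      "\<forall>\<omega>\<in>space M. \<omega> \<notin> T \<longrightarrow> (\<exists>n<K. uncrossed (range (points \<omega>)) (E \<omega>) (m + 2 * real N * real n))"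
    using uncrossed_in_grid[OF N(2)] unfolding p_def by blast
  have "(1 - p) ^ K \<le> exp (- p) ^ K"
    using p exp_ge_add_one_self[of "- p"] by (intro power_mono) auto
  also have "\<dots> = exp (- (p * real K))" by (simp add: exp_of_nat_mult[symmetric] mult.commute)
  also have "\<dots> \<le> exp (ln (\<eta> / 2))" using K j by simp
  also have "\<dots> = \<eta> / 2" using \<open>\<eta> > 0\<close> by simp
  finally have "(1 - p) ^ K \<le> \<eta> / 2" .
  moreover have "real K * (p * crossing_rate N) \<le> \<eta> / 2"
  proof -
    have "real K * (p * crossing_rate N) = (p * real K) * crossing_rate N" by simp
    also have "\<dots> \<le> (real j + 1) * (\<eta> / (2 * (real j + 1)))"
      using K N crossing_rate_nonneg by (intro mult_mono) auto
    also have "\<dots> = \<eta> / 2"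
    proof -
      have "J * (\<eta> / (2 * J)) = \<eta> / 2" if "J > 0" for J :: real using that by simp
      from this[of "real j + 1"] show ?thesis by simp
    qed
    finally show ?thesis .
  qed
  ultimately have "prob T \<le> \<eta>" using T(2) by linarith
  moreover have "AE \<omega> in M. \<omega> \<notin> T \<longrightarrow> (\<exists>c. P c \<and> uncrossed (range (points \<omega>)) (E \<omega>) c)"
    using T(3) m by (intro AE_I2) blast
  ultimately show "\<exists>T\<in>events. prob T \<le> \<eta> \<and>
      (AE \<omega> in M. \<omega> \<notin> T \<longrightarrow> (\<exists>c. P c \<and> uncrossed (range (points \<omega>)) (E \<omega>) c))"
    using T(1) by blast
qed

text \<open>A grid of a single gap: the chance that it is void decays exponentially in its length,
  and otherwise it contains a vertex.\<close>

lemma AE_vertex: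
  assumes P: "\<And>N. \<exists>m. \<forall>x\<in>gap m N. P x"
  shows "AE \<omega> in M. \<exists>x\<in>range (points \<omega>). P x"
proof (rule AE_small_exception)
  fix \<eta> :: real assume "\<eta> > 0"
  obtain N :: nat where N: "- ln \<eta> / (2 * lam) < real N" using reals_Archimedean2 by blast
  obtain m where m: "\<forall>x\<in>gap m (Suc N). P x" using P by blast
  define T where "T = {\<omega> \<in> space M. points \<omega> \<in> avoiding (gap m (Suc N))}"
  have G[measurable]: "gap m (Suc N) \<in> sets borel" by (simp add: gap_def)
  have "T \<in> events" unfolding T_def by measurable
  have "space M - T = {\<omega> \<in> space M. \<forall>n<1. points \<omega> \<notin> avoiding (gap (m + 2 * real (Suc N) * real n) (Suc N))}"
    by (auto simp: T_def)
  then have "prob (space M - T) = 1 - exp (- (lam * (2 * real (Suc N))))"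
    using no_gap_prob(2)[where N = "Suc N" and K = 1 and m = m] by (simp del: of_nat_Suc)
  then have "prob T = exp (- (lam * (2 * real (Suc N))))"
    using prob_compl[OF \<open>T \<in> events\<close>] by simp
  also have "\<dots> \<le> exp (ln \<eta>)"
    using N intensity by (simp add: field_simps)
  also have "\<dots> = \<eta>" using \<open>\<eta> > 0\<close> by simp
  finally have "prob T \<le> \<eta>" .
  moreover have "AE \<omega> in M. \<omega> \<notin> T \<longrightarrow> (\<exists>x\<in>range (points \<omega>). P x)"
    using m by (intro AE_I2) (auto simp: T_def avoiding_def)
  ultimately show "\<exists>T\<in>events. prob T \<le> \<eta> \<and> (AE \<omega> in M. \<omega> \<notin> T \<longrightarrow> (\<exists>x\<in>range (points \<omega>). P x))"
    using \<open>T \<in> events\<close> by blast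
qed

text \<open>Only countably many almost sure statements can be combined, so the thresholds are
  natural numbers \<open>b\<close>; every real threshold is passed by one of them.\<close>

lemma AE_line_graph: "AE \<omega> in M. line_graph (range (points \<omega>)) (E \<omega>)"
proof -
  have up: "\<exists>m. \<forall>n<K. real b < m + 2 * real N * real n" for b N K
    by (intro exI[of _ "real b + 1"]) (simp add: add_strict_increasing)
  have down: "\<exists>m. \<forall>n<K. m + 2 * real N * real n < - real b" for b N K
  \<comment> \<open>The grid extends to the right of \<open>m\<close>, so on the negative side
    \<open>m\<close> is moved back by the full grid length
    \<open>2 * real N * real K\<close>.\<close>
  proof (intro exI[of _ "- real b - 1 - 2 * real N * real K"] allI impI)
    fix n assume "n < K"
    then have "2 * real N * real n \<le> 2 * real N * real K" by (intro mult_left_mono) auto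
    then show "- real b - 1 - 2 * real N * real K + 2 * real N * real n < - real b" by linarith
  qed
  have "AE \<omega> in M. \<exists>x\<in>range (points \<omega>). real b < x" for b
    by (rule AE_vertex) (auto simp: gap_def intro!: exI[of _ "real b + 1"])
  then have v1: "AE \<omega> in M. \<forall>b. \<exists>x\<in>range (points \<omega>). real b < x"
    unfolding AE_all_countable by blast
  have "AE \<omega> in M. \<exists>x\<in>range (points \<omega>). x < - real b" for b
  proof (rule AE_vertex)
    fix N show "\<exists>m. \<forall>x\<in>gap m N. x < - real b"
      by (intro exI[of _ "- real b - 2 * real N"]) (simp add: gap_def)
  qed
  then have v2: "AE \<omega> in M. \<forall>b. \<exists>x\<in>range (points \<omega>). x < - real b"
    unfolding AE_all_countable by blast
  have c1: "AE \<omega> in M. \<forall>b. \<exists>c. real b < c \<and> uncrossed (range (points \<omega>)) (E \<omega>) c"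
    unfolding AE_all_countable by (intro allI AE_uncrossed up)
  have c2: "AE \<omega> in M. \<forall>b. \<exists>c. c < - real b \<and> uncrossed (range (points \<omega>)) (E \<omega>) c"
    unfolding AE_all_countable by (intro allI AE_uncrossed down)
  show ?thesis
    using AE_locally_finite v1 v2 c1 c2
  proof eventually_elim
    case (elim \<omega>)
    have nat: "\<exists>b. K < real b" "\<exists>b. - real b < K" for K
      using reals_Archimedean2[of K] reals_Archimedean2[of "- K"] by (auto simp: minus_less_iff)
    show ?case
    proof unfold_locales
      fix K :: real
      show "\<exists>x\<in>range (points \<omega>). K < x" "\<exists>c>K. uncrossed (range (points \<omega>)) (E \<omega>) c"
        using elim(2,4) nat(1)[of K] by (meson order_less_trans)+
      show "\<exists>x\<in>range (points \<omega>). x < K" "\<exists>c<K. uncrossed (range (points \<omega>)) (E \<omega>) c"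
        using elim(3,5) nat(2)[of K] by (meson order_less_trans)+
    qed (use elim(1) in blast)
  qed
qed

end

theorem corollary2p3:
  fixes lam \<alpha> \<gamma> \<delta> :: real
    and M :: "'w measure"
    and X :: "nat \<Rightarrow> 'w \<Rightarrow> real" and U :: "nat \<Rightarrow> 'w \<Rightarrow> real" and E :: "'w \<Rightarrow> real set set"
    and V :: "'w \<Rightarrow> real set" and E' :: "'w \<Rightarrow> real set set"
  assumes "lam > 0" and "\<alpha> \<ge> 0" and "\<gamma> \<ge> 0" and "\<delta> > 1"
    and "wdrcm M lam (\<lambda>x. min 1 (x powr - \<delta>))
           (\<lambda>s t. min s t powr \<gamma> * max s t powr \<alpha>) X U E"
    and "V = (\<lambda>\<omega>. range (\<lambda>n. X n \<omega>))"
    and "E' = (\<lambda>\<omega>. E \<omega> \<union> nearest_neighbour_edges (V \<omega>))"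
    and "\<delta> > 2" and "\<gamma> < 1 - 1 / \<delta>" and "\<alpha> < 1 - \<gamma>"
  shows "AE \<omega> in M.
           recurrent_graph (V \<omega>) (E' \<omega>) \<and>
           (\<exists>C. {C' \<in> graph_components (V \<omega>) (E' \<omega>). infinite C'} = {C} \<and>
                recurrent_component (V \<omega>) (E' \<omega>) C)"
proof -
  obtain \<theta> \<zeta> \<kappa> where \<theta>: "\<theta> > 0" and \<zeta>: "\<zeta> > 1" and \<kappa>: "0 \<le> \<kappa>" "\<kappa> < \<delta> - 2"
    and exps: "\<gamma> * \<delta> + \<theta> - 1 \<le> \<kappa> / \<zeta>" "(\<gamma> + \<alpha>) * \<delta> + 2 * \<theta> - 2 \<le> \<kappa> / \<zeta>"
    using kernel_exponents[OF assms(8-10)] by metis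
  interpret wdrcm M lam "\<lambda>x. min 1 (x powr - \<delta>)" "\<lambda>s t. min s t powr \<gamma> * max s t powr \<alpha>" X U E
    by (rule assms(5))
  \<comment> \<open>Here \<tau> = (\<delta> - \<kappa>) / 2 exceeds 1 because \<kappa> < \<delta> -
    2, and the minimum with 1 in the profile is bounded by its power term.\<close>
  interpret line_model M lam "\<lambda>x. min 1 (x powr - \<delta>)" "\<lambda>s t. min s t powr \<gamma> * max s t powr \<alpha>" X U E
    \<theta> "(\<delta> - \<kappa>) / 2" \<zeta>
  proof unfold_locales
    fix s t x y r :: real
    assume "s \<in> {0<..<1}" "t \<in> {0<..<1}" "0 < x" "0 < y" "x + y \<le> r" "x powr - \<zeta> \<le> s" "y powr - \<zeta> \<le> t"
    from profile_kernel_bound[OF this assms(8) \<zeta> \<kappa> exps refl]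
    show "min 1 ((min s t powr \<gamma> * max s t powr \<alpha> * r) powr - \<delta>) \<le>
        s powr (\<theta> - 1) * t powr (\<theta> - 1) * (x powr - ((\<delta> - \<kappa>) / 2) * y powr - ((\<delta> - \<kappa>) / 2))"
      by linarith
  qed (use \<theta> \<zeta> \<kappa> in \<open>simp_all add: min.commute max.commute\<close>)
  show ?thesis
    using AE_line_graph
  proof eventually_elim
    case (elim \<omega>)
    then interpret line_graph "range (points \<omega>)" "E \<omega>" .
    show ?case unfolding assms(6,7) using recurrent unfolding E'_def .
  qed
qed

end
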